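(* Let $a>0$, let $w\ne0$ be real, let $\alpha$ be real with $0<|\alpha|<1$, and let $f$ and $g$ be suitably smooth functions on $[0,a]$ with $g$ real-valued, $g(0)=0$ and $g'(x)>0$ for $x\in[0,a]$. Let $0=x_0<x_1<\cdots<x_n=a$ be nodes with multiplicities $m_0,\ldots,m_n\ge1$, let $M=\sum_{j=0}^nm_j-1$ and $s=\min(m_0,m_n)-1$. Then the Filon-type method $Q_{w,n}^{F,s}[f]$ (for the integral $\int_0^a f(x)x^\alpha\log(x)e^{iwg(x)}dx$) based on the basis set $\Psi_{M+1}=\{g',g'g,\ldots,g'g^{M}\}$ is identical to the Levin method $Q_{w,n}^{L,s}[f]$ using the basis set $\Phi_M=\{1,g,\ldots,g^{M-1}\}$; that is, $$Q_{w,n}^{F,s}[f]=Q_{w,n}^{L,s}[f].$$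
   Context: "Suitably smooth" means having as many continuous derivatives on $[0,a]$ as needed (it may be read as $C^\infty[0,a]$). For a function $F$ on $[0,a]$ put $F_1(x)=F(x)\left(\frac{x}{g(x)}\right)^\alpha$ for $x\ne0$ and $F_1(0)=F(0)/(g'(0))^\alpha$; in particular $f_1$ is this function for $F=f$. Also $f_2(x)=f(x)\log\frac{x}{g(x)}$ for $x\neq0$, $f_2(0)=f(0)\log\frac1{g'(0)}$. For a number $c$ and a function $q$, $$\mathcal{W}[c,q](x)=iwg'(x)c+g(x)q'(x)+[1+\alpha+iwg(x)]g'(x)q(x).$$ "$u$ matches $v$ at the nodes" means $u^{(j)}(x_l)=v^{(j)}(x_l)$ for $j=0,\ldots,m_l-1$, $l=0,\ldots,n$. Methods for the algebraic singularity. Filon-type: $Q_{w,\alpha,n}^{F,s}[F]=\int_0^aP(x)g^\alpha(x)e^{iwg(x)}dx$, where $P\in\operatorname{span}\Psi_{M+1}$ matches $F_1$ at the nodes. Levin: with $\gamma_0$ and $r\in\operatorname{span}\Phi_M$ such that $\mathcal{W}[\gamma_0,r]$ matches $F_1$ at the nodes, and $H(x)=\alpha\gamma_0e^{-iwg(x)}\int_0^x\frac{g'(t)(1-e^{iwg(t)})}{g^{1-\alpha}(t)}dt$, $$Q_{w,\alpha,n}^{L,s}[F]=\left.\left[g^{\alpha+1}(x)r(x)+\gamma_0(1-e^{-iwg(x)})g^\alpha(x)+H(x)\right]e^{iwg(x)}\right|_0^a.$$ Methods for the algebraic and logarithmic singularity. Filon-type: $$Q_{w,n}^{F,s}[f]=Q_{w,\alpha,n}^{F,s}[f_2]+\int_0^ap(x)g^\alpha(x)\log(g(x))e^{iwg(x)}dx,$$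 where $p\in\operatorname{span}\Psi_{M+1}$ matches $f_1$ at the nodes. Levin: let $c_0,d_0$ be numbers and $q_1,\ell_1\in\operatorname{span}\Phi_M$ such that $\mathcal{W}[c_0,q_1]$ matches $f_1$ at the nodes and $\mathcal{W}[d_0,\ell_1]$ matches $-q_1g'$ at the nodes; let $$h(x)=e^{-iwg(x)}\int_0^x\bigl(\alpha c_0\log g(t)+\alpha d_0+c_0\bigr)g'(t)\frac{1-e^{iwg(t)}}{g^{1-\alpha}(t)}\,dt,$$ $$Q_{w,n}^{L,s}[f]=Q_{w,\alpha,n}^{L,s}[f_2]+\left.\left[(q_1(x)\log g(x)+\ell_1(x))g^{1+\alpha}(x)+(c_0\log g(x)+d_0)(1-e^{-iwg(x)})g^\alpha(x)+h(x)\right]e^{iwg(x)}\right|_0^a.$$ In all these formulas the value at $x=0$ is understood as the limit $x\to0^+$ (which is $0$). *)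

theory Defs
  imports "HOL-Analysis.Analysis"
begin

text \<open>
  Throughout, \<open>a\<close> is the right end of the interval \<open>[0, a]\<close>, \<open>w\<close> the frequency, \<open>\<alpha>\<close> the exponent,
  \<open>g\<close> the phase, \<open>x 0, \<dots>, x n\<close> the nodes and \<open>m 0, \<dots>, m n\<close> their multiplicities, and
  \<open>M + 1\<close> is the number of interpolation conditions. Amplitudes are complex valued. The order
  \<open>s = min (m 0) (m n) - 1\<close> is only a label of the methods and enters none of the formulas.
\<close>

text \<open>All derivatives are taken within \<open>[0, a]\<close>, hence are one-sided at the two end points.\<close>

definition deriv_on :: "real \<Rightarrow> (real \<Rightarrow> 'a::real_normed_vector) \<Rightarrow> real \<Rightarrow> 'a" where
  "deriv_on a u = (\<lambda>t. vector_derivative u (at t within {0..a}))"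

definition smooth_on_Icc :: "real \<Rightarrow> (real \<Rightarrow> 'a::real_normed_vector) \<Rightarrow> bool" where
  "smooth_on_Icc a u \<longleftrightarrow>
     (\<forall>k. \<forall>t\<in>{0..a}. (deriv_on a ^^ k) u differentiable (at t within {0..a}))"

definition matches_at_nodes ::
  "real \<Rightarrow> nat \<Rightarrow> (nat \<Rightarrow> real) \<Rightarrow> (nat \<Rightarrow> nat) \<Rightarrow> (real \<Rightarrow> complex) \<Rightarrow> (real \<Rightarrow> complex) \<Rightarrow> bool" where
  "matches_at_nodes a n x m u v \<longleftrightarrow>
     (\<forall>l\<le>n. \<forall>j<m l. (deriv_on a ^^ j) u (x l) = (deriv_on a ^^ j) v (x l))"

definition cspan :: "(nat \<Rightarrow> real \<Rightarrow> complex) \<Rightarrow> nat \<Rightarrow> (real \<Rightarrow> complex) set" where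
  "cspan b N = {u. \<exists>c. u = (\<lambda>t. \<Sum>k<N. c k * b k t)}"

definition Psi :: "real \<Rightarrow> (real \<Rightarrow> real) \<Rightarrow> nat \<Rightarrow> real \<Rightarrow> complex" where
  "Psi a g k = (\<lambda>t. of_real (deriv_on a g t * g t ^ k))"

definition Phi :: "(real \<Rightarrow> real) \<Rightarrow> nat \<Rightarrow> real \<Rightarrow> complex" where
  "Phi g k = (\<lambda>t. of_real (g t ^ k))"

text \<open>The functions written \<open>F\<^sub>1\<close> (for arbitrary \<open>F\<close>) and \<open>f\<^sub>2\<close>.\<close>

definition reg_alg :: "real \<Rightarrow> real \<Rightarrow> (real \<Rightarrow> real) \<Rightarrow> (real \<Rightarrow> complex) \<Rightarrow> real \<Rightarrow> complex" where
  "reg_alg a \<alpha> g F = (\<lambda>t. if t = 0 then F 0 / of_real (deriv_on a g 0 powr \<alpha>)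
                            else F t * of_real ((t / g t) powr \<alpha>))"

definition reg_log :: "real \<Rightarrow> (real \<Rightarrow> real) \<Rightarrow> (real \<Rightarrow> complex) \<Rightarrow> real \<Rightarrow> complex" where
  "reg_log a g f = (\<lambda>t. if t = 0 then f 0 * of_real (ln (1 / deriv_on a g 0))
                          else f t * of_real (ln (t / g t)))"

definition osc :: "real \<Rightarrow> (real \<Rightarrow> real) \<Rightarrow> real \<Rightarrow> complex" where
  "osc w g = (\<lambda>t. exp (\<i> * of_real w * of_real (g t)))"

definition levin_op ::
  "real \<Rightarrow> real \<Rightarrow> real \<Rightarrow> (real \<Rightarrow> real) \<Rightarrow> complex \<Rightarrow> (real \<Rightarrow> complex) \<Rightarrow> real \<Rightarrow> complex" where
  "levin_op a w \<alpha> g c q = (\<lambda>t.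
     \<i> * of_real w * of_real (deriv_on a g t) * c + of_real (g t) * deriv_on a q t
     + (1 + of_real \<alpha> + \<i> * of_real w * of_real (g t)) * of_real (deriv_on a g t) * q t)"

text \<open>
  Membership in the span is required on all of the real line, not just on \<open>[0, a]\<close>, so that an
  interpolant is unique as a function and a definite description is appropriate.
\<close>

definition filon_interpolant ::
  "real \<Rightarrow> (real \<Rightarrow> real) \<Rightarrow> nat \<Rightarrow> (nat \<Rightarrow> real) \<Rightarrow> (nat \<Rightarrow> nat) \<Rightarrow> nat \<Rightarrow>
   (real \<Rightarrow> complex) \<Rightarrow> real \<Rightarrow> complex" where
  "filon_interpolant a g n x m M v =
     (THE P. P \<in> cspan (Psi a g) (M + 1) \<and> matches_at_nodes a n x m P v)"

definition levin_pair ::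
  "real \<Rightarrow> real \<Rightarrow> real \<Rightarrow> (real \<Rightarrow> real) \<Rightarrow> nat \<Rightarrow> (nat \<Rightarrow> real) \<Rightarrow> (nat \<Rightarrow> nat) \<Rightarrow> nat \<Rightarrow>
   (real \<Rightarrow> complex) \<Rightarrow> complex \<times> (real \<Rightarrow> complex)" where
  "levin_pair a w \<alpha> g n x m M v =
     (THE (c, q). q \<in> cspan (Phi g) M \<and> matches_at_nodes a n x m (levin_op a w \<alpha> g c q) v)"

text \<open>\<open>B|\<^sub>0\<^sup>a\<close>, where the value at \<open>0\<close> is the limit from the right.\<close>

definition bracket :: "real \<Rightarrow> (real \<Rightarrow> complex) \<Rightarrow> complex" where
  "bracket a B = B a - Lim (at_right 0) B"

definition filon_alg ::
  "real \<Rightarrow> real \<Rightarrow> real \<Rightarrow> (real \<Rightarrow> real) \<Rightarrow> nat \<Rightarrow> (nat \<Rightarrow> real) \<Rightarrow> (nat \<Rightarrow> nat) \<Rightarrow> nat \<Rightarrow>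
   (real \<Rightarrow> complex) \<Rightarrow> complex" where
  "filon_alg a w \<alpha> g n x m M F =
     (let P = filon_interpolant a g n x m M (reg_alg a \<alpha> g F)
      in integral {0..a} (\<lambda>t. P t * of_real (g t powr \<alpha>) * osc w g t))"

definition levin_alg ::
  "real \<Rightarrow> real \<Rightarrow> real \<Rightarrow> (real \<Rightarrow> real) \<Rightarrow> nat \<Rightarrow> (nat \<Rightarrow> real) \<Rightarrow> (nat \<Rightarrow> nat) \<Rightarrow> nat \<Rightarrow>
   (real \<Rightarrow> complex) \<Rightarrow> complex" where
  "levin_alg a w \<alpha> g n x m M F =
     (let (\<gamma>, r) = levin_pair a w \<alpha> g n x m M (reg_alg a \<alpha> g F);
          H = (\<lambda>t. of_real \<alpha> * \<gamma> * osc (- w) g t *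
                 integral {0..t} (\<lambda>\<tau>. of_real (deriv_on a g \<tau>) * (1 - osc w g \<tau>)
                                        / of_real (g \<tau> powr (1 - \<alpha>))))
      in bracket a (\<lambda>t. (of_real (g t powr (\<alpha> + 1)) * r t
                           + \<gamma> * (1 - osc (- w) g t) * of_real (g t powr \<alpha>) + H t) * osc w g t))"

definition filon_log ::
  "real \<Rightarrow> real \<Rightarrow> real \<Rightarrow> (real \<Rightarrow> real) \<Rightarrow> nat \<Rightarrow> (nat \<Rightarrow> real) \<Rightarrow> (nat \<Rightarrow> nat) \<Rightarrow> nat \<Rightarrow>
   (real \<Rightarrow> complex) \<Rightarrow> complex" where
  "filon_log a w \<alpha> g n x m M f =
     (let p = filon_interpolant a g n x m M (reg_alg a \<alpha> g f)
      in filon_alg a w \<alpha> g n x m M (reg_log a g f)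
         + integral {0..a} (\<lambda>t. p t * of_real (g t powr \<alpha>) * of_real (ln (g t)) * osc w g t))"

definition levin_log ::
  "real \<Rightarrow> real \<Rightarrow> real \<Rightarrow> (real \<Rightarrow> real) \<Rightarrow> nat \<Rightarrow> (nat \<Rightarrow> real) \<Rightarrow> (nat \<Rightarrow> nat) \<Rightarrow> nat \<Rightarrow>
   (real \<Rightarrow> complex) \<Rightarrow> complex" where
  "levin_log a w \<alpha> g n x m M f =
     (let (c, q) = levin_pair a w \<alpha> g n x m M (reg_alg a \<alpha> g f);
          (d, l) = levin_pair a w \<alpha> g n x m M (\<lambda>t. - q t * of_real (deriv_on a g t));
          h = (\<lambda>t. osc (- w) g t *
                 integral {0..t} (\<lambda>\<tau>. (of_real \<alpha> * c * of_real (ln (g \<tau>)) + of_real \<alpha> * d + c)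
                                        * of_real (deriv_on a g \<tau>)
                                        * ((1 - osc w g \<tau>) / of_real (g \<tau> powr (1 - \<alpha>)))))
      in levin_alg a w \<alpha> g n x m M (reg_log a g f)
         + bracket a (\<lambda>t. ((q t * of_real (ln (g t)) + l t) * of_real (g t powr (1 + \<alpha>))
                             + (c * of_real (ln (g t)) + d) * (1 - osc (- w) g t)
                                 * of_real (g t powr \<alpha>) + h t) * osc w g t))"

end

theory Submission
  imports Defs
begin

text \<open>
  Both methods turn out to integrate the same interpolants exactly.

  Write an element of the span of \<open>\<Psi>\<^bsub>M+1\<^esub>\<close> as \<open>g' \<rho>(g)\<close> and an element of the span of \<open>\<Phi>\<^sub>M\<close> as
  \<open>q = \<pi>(g)\<close>, with polynomials of degree at most \<open>M\<close> and below \<open>M\<close>. The operator of the Levin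
  method sends \<open>(c, q)\<close> to some \<open>g' \<rho>(g)\<close>, and the map from \<open>(c, \<pi>)\<close> to \<open>\<rho>\<close> is linear and
  triangular with diagonal entries \<open>i w \<noteq> 0\<close>; so it is a bijection (\<open>levin_poly_inject\<close>,
  \<open>levin_poly_surj\<close>). Hermite interpolation by functions \<open>g' \<rho>(g)\<close> is uniquely solvable, since \<open>g'\<close>
  has no zeros and \<open>g\<close> separates the nodes (\<open>hermite_exists\<close>, \<open>hermite_unique\<close>). Consequently the
  operator maps the Levin pair for some data exactly onto the Filon interpolant of the same data
  (\<open>filon_levin_interpolants\<close>), on the whole interval and not just at the nodes.

  It remains to see that the bracket of the Levin method is the integral of that interpolant. With
  \<open>W[c, q]\<close> denoting \<open>levin_op\<close>, the function between the brackets is an antiderivative of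
  \<open>(W[c, q] log g + q g' + W[d, l]) g\<^sup>\<alpha> e\<^bsup>iwg\<^esup>\<close> that tends to \<open>0\<close> at \<open>0\<close> (\<open>levin_integral\<close>). For
  \<open>c = 0\<close> and \<open>q = 0\<close> this settles the algebraic singularity. In the logarithmic case \<open>W[c, q]\<close> is the
  interpolant \<open>p\<close>, while the data \<open>- q g'\<close> of the second collocation problem themselves lie in the span
  of \<open>\<Psi>\<^bsub>M+1\<^esub>\<close>. So \<open>W[d, l] = - q g'\<close> on \<open>[0, a]\<close>, and only \<open>p g\<^sup>\<alpha> log g e\<^bsup>iwg\<^esup>\<close> is left.
\<close>

section \<open>Iterated derivatives on a closed interval\<close>

lemma deriv_on_eqI:
  assumes "0 < a" "t \<in> {0..a}" "(u has_vector_derivative d) (at t within {0..a})"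
  shows "deriv_on a u t = d"
  unfolding deriv_on_def
  by (rule vector_derivative_within_cbox[of 0 a t u d, unfolded cbox_interval, OF assms])

lemma deriv_on_works:
  assumes "u differentiable (at t within {0..a})"
  shows "(u has_vector_derivative deriv_on a u t) (at t within {0..a})"
  using assms unfolding deriv_on_def vector_derivative_works .

lemma has_vector_derivative_cong_on:
  assumes "\<And>t. t \<in> S \<Longrightarrow> u t = v t" "t \<in> S"
  shows "(u has_vector_derivative d) (at t within S) \<longleftrightarrow> (v has_vector_derivative d) (at t within S)"
proof
  show "(u has_vector_derivative d) (at t within S) \<Longrightarrow> (v has_vector_derivative d) (at t within S)"
    by (rule has_vector_derivative_transform[OF assms(2)]) (rule assms(1)[symmetric])
  show "(v has_vector_derivative d) (at t within S) \<Longrightarrow> (u has_vector_derivative d) (at t within S)"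
    by (rule has_vector_derivative_transform[OF assms(2)]) (rule assms(1))
qed

lemma differentiable_cong_on:
  fixes u v :: "real \<Rightarrow> 'a::real_normed_vector"
  assumes "\<And>t. t \<in> S \<Longrightarrow> u t = v t" "t \<in> S"
  shows "u differentiable (at t within S) \<longleftrightarrow> v differentiable (at t within S)"
proof -
  have *: "w differentiable (at t within S) \<longleftrightarrow> (\<exists>d. (w has_vector_derivative d) (at t within S))"
    for w :: "real \<Rightarrow> 'a"
    by (blast intro: differentiableI_vector dest: vector_derivative_works[THEN iffD1])
  show ?thesis
    unfolding * by (intro ex_cong1 has_vector_derivative_cong_on assms)
qed

lemma deriv_on_cong:
  assumes "\<And>t. t \<in> {0..a} \<Longrightarrow> u t = v t" "t \<in> {0..a}"
  shows "deriv_on a u t = deriv_on a v t"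
  unfolding deriv_on_def vector_derivative_def
  by (rule arg_cong[where f = Eps], rule ext, rule has_vector_derivative_cong_on[OF assms])

text \<open>
  Derivatives are taken within \<open>[0, a]\<close>, so nothing outside the interval can influence them. This
  is what allows a matching condition to be transferred between functions, such as
  \<open>levin_op a w \<alpha> g c q\<close> and an element of the span, that are only known to coincide on \<open>[0, a]\<close>.
\<close>

lemma iterated_deriv_on_cong:
  assumes "\<And>t. t \<in> {0..a} \<Longrightarrow> u t = v t" "t \<in> {0..a}"
  shows "(deriv_on a ^^ k) u t = (deriv_on a ^^ k) v t"
  using assms
proof (induction k arbitrary: t)
  case (Suc k)
  show ?case
    unfolding funpow.simps comp_def
    by (rule deriv_on_cong[OF Suc.IH[OF Suc.prems(1)] Suc.prems(2)])
qed simp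

lemma matches_at_nodes_cong:
  assumes "\<And>t. t \<in> {0..a} \<Longrightarrow> u t = u' t" "\<And>t. t \<in> {0..a} \<Longrightarrow> v t = v' t"
    "\<And>l. l \<le> n \<Longrightarrow> x l \<in> {0..a}"
  shows "matches_at_nodes a n x m u v \<longleftrightarrow> matches_at_nodes a n x m u' v'"
proof -
  have "(deriv_on a ^^ j) u (x l) = (deriv_on a ^^ j) u' (x l)"
    "(deriv_on a ^^ j) v (x l) = (deriv_on a ^^ j) v' (x l)" if "l \<le> n" for j l
    by (intro iterated_deriv_on_cong assms that; assumption)+
  then show ?thesis
    by (simp add: matches_at_nodes_def)
qed

text \<open>
  Smoothness of a product cannot be proved by induction on the order for one fixed pair of factors,
  since differentiating produces other products. Counting the available derivatives gives a
  notion that can be inducted on for all pairs at once: one order is used up per differentiation.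
\<close>

definition diff_upto :: "real \<Rightarrow> nat \<Rightarrow> (real \<Rightarrow> 'a::real_normed_vector) \<Rightarrow> bool" where
  "diff_upto a k u \<longleftrightarrow> (\<forall>j<k. \<forall>t\<in>{0..a}. (deriv_on a ^^ j) u differentiable (at t within {0..a}))"

lemma smooth_iff_diff_upto: "smooth_on_Icc a u \<longleftrightarrow> (\<forall>k. diff_upto a k u)"
  unfolding smooth_on_Icc_def diff_upto_def by blast

lemma diff_upto_0: "diff_upto a 0 u"
  by (simp add: diff_upto_def)

lemma diff_upto_Suc:
  "diff_upto a (Suc k) u \<longleftrightarrow>
     (\<forall>t\<in>{0..a}. u differentiable (at t within {0..a})) \<and> diff_upto a k (deriv_on a u)"
  unfolding diff_upto_def All_less_Suc2 by (simp add: funpow_swap1)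

lemma diff_upto_SucD: "diff_upto a (Suc k) u \<Longrightarrow> diff_upto a k u"
  by (simp add: diff_upto_def)

lemma diff_upto_cong:
  assumes "\<And>t. t \<in> {0..a} \<Longrightarrow> u t = v t" "diff_upto a k v"
  shows "diff_upto a k u"
  unfolding diff_upto_def
proof (intro allI impI ballI)
  fix j t assume "j < k" "t \<in> {0..a}"
  then have "(deriv_on a ^^ j) v differentiable (at t within {0..a})"
    using assms(2) by (simp add: diff_upto_def)
  then show "(deriv_on a ^^ j) u differentiable (at t within {0..a})"
    using differentiable_cong_on[of "{0..a}" "(deriv_on a ^^ j) u" "(deriv_on a ^^ j) v" t]
      iterated_deriv_on_cong[of a u v] assms(1) \<open>t \<in> {0..a}\<close> by blast
qed

lemma smooth_on_Icc_iff:
  "smooth_on_Icc a u \<longleftrightarrow>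
     (\<forall>t\<in>{0..a}. u differentiable (at t within {0..a})) \<and> smooth_on_Icc a (deriv_on a u)"
  unfolding smooth_iff_diff_upto using diff_upto_Suc diff_upto_SucD by blast

lemma smooth_has_deriv_on:
  assumes "smooth_on_Icc a u" "t \<in> {0..a}"
  shows "(u has_vector_derivative deriv_on a u t) (at t within {0..a})"
  using assms smooth_on_Icc_iff deriv_on_works by blast

lemma smooth_deriv_on: "smooth_on_Icc a u \<Longrightarrow> smooth_on_Icc a (deriv_on a u)"
  using smooth_on_Icc_iff by blast

context
  fixes a :: real
  assumes a: "0 < a"
begin

lemma diff_upto_SucI:
  assumes "\<And>t. t \<in> {0..a} \<Longrightarrow> (u has_vector_derivative u' t) (at t within {0..a})"
    and "diff_upto a k u'"
  shows "diff_upto a (Suc k) u"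
  unfolding diff_upto_Suc
proof
  show "\<forall>t\<in>{0..a}. u differentiable (at t within {0..a})"
    using assms(1) differentiableI_vector by blast
  show "diff_upto a k (deriv_on a u)"
    by (rule diff_upto_cong[OF _ assms(2)]) (rule deriv_on_eqI[OF a _ assms(1)])
qed

lemma diff_upto_has_deriv_on:
  assumes "diff_upto a (Suc k) u" "t \<in> {0..a}"
  shows "(u has_vector_derivative deriv_on a u t) (at t within {0..a})"
  using assms diff_upto_Suc deriv_on_works by blast

lemma diff_upto_const: "diff_upto a k (\<lambda>_. c)"
proof (induction k arbitrary: c)
  case (Suc k)
  show ?case by (rule diff_upto_SucI[OF has_vector_derivative_const Suc])
qed (rule diff_upto_0)

lemma diff_upto_add:
  assumes "diff_upto a k u" "diff_upto a k v"
  shows "diff_upto a k (\<lambda>t. u t + v t)"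
  using assms
proof (induction k arbitrary: u v)
  case (Suc k)
  show ?case
    by (rule diff_upto_SucI[OF has_vector_derivative_add])
      (use Suc diff_upto_has_deriv_on diff_upto_Suc in blast)+
qed (rule diff_upto_0)

lemma diff_upto_mult:
  fixes u v :: "real \<Rightarrow> 'b::real_normed_algebra"
  assumes "diff_upto a k u" "diff_upto a k v"
  shows "diff_upto a k (\<lambda>t. u t * v t)"
  using assms
proof (induction k arbitrary: u v)
  case (Suc k)
  have "diff_upto a k (\<lambda>t. u t * deriv_on a v t + deriv_on a u t * v t)"
    using Suc.prems diff_upto_Suc diff_upto_SucD by (intro diff_upto_add Suc.IH) blast+
  then show ?case
    by (rule diff_upto_SucI[OF has_vector_derivative_mult, rotated 2])
      (use Suc.prems diff_upto_has_deriv_on in blast)+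
qed (rule diff_upto_0)

lemma diff_upto_of_real:
  assumes "diff_upto a k u"
  shows "diff_upto a k (\<lambda>t. of_real (u t) :: complex)"
  using assms
proof (induction k arbitrary: u)
  case (Suc k)
  show ?case
    by (rule diff_upto_SucI[OF has_vector_derivative_of_real])
      (use Suc diff_upto_has_deriv_on diff_upto_Suc
        has_real_derivative_iff_has_vector_derivative in blast)+
qed (rule diff_upto_0)

lemma smooth_const: "smooth_on_Icc a (\<lambda>_. c)"
  and smooth_add: "smooth_on_Icc a u \<Longrightarrow> smooth_on_Icc a v \<Longrightarrow> smooth_on_Icc a (\<lambda>t. u t + v t)"
  by (simp_all add: smooth_iff_diff_upto diff_upto_const diff_upto_add)

lemma smooth_mult:
  fixes u v :: "real \<Rightarrow> 'b::real_normed_algebra"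
  shows "smooth_on_Icc a u \<Longrightarrow> smooth_on_Icc a v \<Longrightarrow> smooth_on_Icc a (\<lambda>t. u t * v t)"
  by (simp add: smooth_iff_diff_upto diff_upto_mult)

lemma smooth_of_real: "smooth_on_Icc a u \<Longrightarrow> smooth_on_Icc a (\<lambda>t. of_real (u t) :: complex)"
  by (simp add: smooth_iff_diff_upto diff_upto_of_real)

lemma iterated_deriv_on_lincomb:
  fixes u v :: "real \<Rightarrow> 'b::real_normed_algebra"
  assumes "smooth_on_Icc a u" "smooth_on_Icc a v" "t \<in> {0..a}"
  shows "(deriv_on a ^^ k) (\<lambda>s. u s + c * v s) t
           = (deriv_on a ^^ k) u t + c * (deriv_on a ^^ k) v t"
  using assms
proof (induction k arbitrary: u v)
  case (Suc k)
  have "deriv_on a (\<lambda>s. u s + c * v s) s = deriv_on a u s + c * deriv_on a v s"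
    if "s \<in> {0..a}" for s
    by (intro deriv_on_eqI a that has_vector_derivative_add has_vector_derivative_mult_right
        smooth_has_deriv_on Suc.prems)
  then have "(deriv_on a ^^ Suc k) (\<lambda>s. u s + c * v s) t
      = (deriv_on a ^^ k) (\<lambda>s. deriv_on a u s + c * deriv_on a v s) t"
    unfolding funpow_Suc_right comp_def by (intro iterated_deriv_on_cong Suc.prems)
  also have "\<dots> = (deriv_on a ^^ Suc k) u t + c * (deriv_on a ^^ Suc k) v t"
    unfolding funpow_Suc_right comp_def by (intro Suc.IH smooth_deriv_on Suc.prems)
  finally show ?case .
qed simp

text \<open>
  Differentiating \<open>(G - G(t))\<^sup>k\<^sup>+\<^sup>1 v\<close> once gives \<open>(G - G(t))\<^sup>k\<close> times the smooth function
  \<open>(k + 1) G' v + (G - G(t)) v'\<close>, whose value at \<open>t\<close> is \<open>(k + 1) G'(t) v(t)\<close>. Hence a zero of order \<open>k\<close>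
  in the variable \<open>G\<close> is a zero of order \<open>k\<close> in the variable \<open>t\<close>, with a leading derivative that is
  known explicitly. This replaces the formula for higher derivatives of a composition.
\<close>

lemma iterated_deriv_on_power_mult:
  fixes G v :: "real \<Rightarrow> complex"
  assumes "smooth_on_Icc a G" "smooth_on_Icc a v" "t \<in> {0..a}"
  shows iterated_deriv_on_power_mult_less:
      "j < k \<Longrightarrow> (deriv_on a ^^ j) (\<lambda>s. (G s - G t) ^ k * v s) t = 0"
    and iterated_deriv_on_power_mult_eq:
      "(deriv_on a ^^ k) (\<lambda>s. (G s - G t) ^ k * v s) t = fact k * deriv_on a G t ^ k * v t"
proof -
  have step: "(deriv_on a ^^ Suc j) (\<lambda>s. (G s - G t) ^ Suc k * v s) t
      = (deriv_on a ^^ j) (\<lambda>s. (G s - G t) ^ k *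
          (of_nat (Suc k) * deriv_on a G s * v s + (G s + (- G t)) * deriv_on a v s)) t"
    if v: "smooth_on_Icc a v" for j k v
  proof -
    have "deriv_on a (\<lambda>s. (G s - G t) ^ Suc k * v s) s = (G s - G t) ^ k *
          (of_nat (Suc k) * deriv_on a G s * v s + (G s + (- G t)) * deriv_on a v s)"
      if s: "s \<in> {0..a}" for s
    proof -
      have G: "((\<lambda>s. G s - G t) has_vector_derivative deriv_on a G s) (at s within {0..a})"
        using has_vector_derivative_diff[OF smooth_has_deriv_on[OF assms(1) s]
            has_vector_derivative_const] by simp
      have "((\<lambda>y. (y :: complex) ^ Suc k) has_field_derivative
             of_nat (Suc k) * (G s - G t) ^ k)
             (at (G s - G t) within (\<lambda>s. G s - G t) ` {0..a})"
        by (rule derivative_eq_intros refl | simp)+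
      from field_vector_diff_chain_within[OF G this]
      have "((\<lambda>s. (G s - G t) ^ Suc k) has_vector_derivative
              deriv_on a G s * (of_nat (Suc k) * (G s - G t) ^ k)) (at s within {0..a})"
        by (simp add: comp_def)
      from has_vector_derivative_mult[OF this smooth_has_deriv_on[OF v s]]
      show ?thesis
        by (intro deriv_on_eqI a s) (simp add: algebra_simps)
    qed
    then show ?thesis
      unfolding funpow_Suc_right comp_def by (intro iterated_deriv_on_cong assms(3))
  qed
  have smooth: "smooth_on_Icc a (\<lambda>s. of_nat (Suc k) * deriv_on a G s * v s
      + (G s + (- G t)) * deriv_on a v s)" if "smooth_on_Icc a v" for k v
    by (intro smooth_add smooth_mult smooth_const smooth_deriv_on assms(1) that)
  show "(deriv_on a ^^ j) (\<lambda>s. (G s - G t) ^ k * v s) t = 0" if "j < k"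
    using that assms(2)
  proof (induction j arbitrary: k v)
    case (Suc j)
    then obtain k' where "k = Suc k'" "j < k'" using Suc_less_eq2 by blast
    show ?case
      unfolding \<open>k = Suc k'\<close> step[OF Suc.prems(2)]
      by (rule Suc.IH[OF \<open>j < k'\<close> smooth[OF Suc.prems(2)]])
  qed simp
  show "(deriv_on a ^^ k) (\<lambda>s. (G s - G t) ^ k * v s) t = fact k * deriv_on a G t ^ k * v t"
    using assms(2)
  proof (induction k arbitrary: v)
    case (Suc k)
    show ?case
      unfolding step[OF Suc.prems] Suc.IH[OF smooth[OF Suc.prems]] by (simp add: algebra_simps)
  qed simp
qed

end

section \<open>Polynomials in the phase\<close>

lemma poly_eq_sum_lessThan:
  fixes \<pi> :: "'a::comm_semiring_1 poly"
  assumes "degree \<pi> < N"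
  shows "poly \<pi> z = (\<Sum>k<N. coeff \<pi> k * z ^ k)"
  unfolding poly_altdef
  by (rule sum.mono_neutral_left) (use assms in \<open>auto simp: coeff_eq_0\<close>)

text \<open>
  Coefficient vectors of length \<open>N\<close> are the same as polynomials of degree below \<open>N\<close>. The hypothesis
  \<open>0 < N\<close> matters because the zero polynomial has degree \<open>0\<close>.
\<close>

lemma cspan_powers:
  assumes "0 < N" and "\<And>k t. b k t = e t * h t ^ k"
  shows "cspan b N = {(\<lambda>t. e t * poly \<pi> (h t)) |\<pi>. degree \<pi> < N}"
proof (intro equalityI subsetI)
  fix u assume "u \<in> cspan b N"
  then obtain c where "u = (\<lambda>t. \<Sum>k<N. c k * b k t)"
    by (auto simp: cspan_def)
  moreover have "degree (\<Sum>k<N. monom (c k) k) < N"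
    using assms(1) by (intro degree_sum_less) (auto intro: le_less_trans[OF degree_monom_le])
  ultimately show "u \<in> {(\<lambda>t. e t * poly \<pi> (h t)) |\<pi>. degree \<pi> < N}"
    by (intro CollectI exI[of _ "\<Sum>k<N. monom (c k) k"])
      (simp add: assms(2) poly_sum poly_monom sum_distrib_left mult_ac)
next
  fix u assume "u \<in> {(\<lambda>t. e t * poly \<pi> (h t)) |\<pi>. degree \<pi> < N}"
  then obtain \<pi> where "degree \<pi> < N" "u = (\<lambda>t. e t * poly \<pi> (h t))"
    by blast
  then have "u = (\<lambda>t. \<Sum>k<N. coeff \<pi> k * b k t)"
    by (simp add: poly_eq_sum_lessThan assms(2) sum_distrib_left mult_ac)
  then show "u \<in> cspan b N"
    unfolding cspan_def by blast
qed

text \<open>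
  The operator \<open>W[c, q]\<close> with the phase as independent variable: for \<open>q = \<pi>(g)\<close> the chain rule
  turns \<open>g q' + (1 + \<alpha> + i w g) g' q + i w g' c\<close> into \<open>g'\<close> times a polynomial in \<open>g\<close>.
\<close>

definition levin_poly :: "real \<Rightarrow> real \<Rightarrow> complex \<Rightarrow> complex poly \<Rightarrow> complex poly" where
  "levin_poly w \<alpha> c \<pi> = [:\<i> * of_real w * c:] + smult (1 + of_real \<alpha>) \<pi>
     + pCons 0 (pderiv \<pi> + smult (\<i> * of_real w) \<pi>)"

text \<open>
  In the monomial basis the operator is bidiagonal. The coefficient \<open>\<pi>\<^sub>k\<close> enters the coefficient of
  index \<open>k + 1\<close> with the nonzero factor \<open>i w\<close>, and \<open>c\<close> enters the constant coefficient with the same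
  factor, so the equation \<open>levin_poly w \<alpha> c \<pi> = \<rho>\<close> can be solved from the top coefficient downwards.
\<close>

lemma coeff_levin_poly_Suc:
  "coeff (levin_poly w \<alpha> c \<pi>) (Suc k)
     = (1 + of_real \<alpha> + of_nat (Suc k)) * coeff \<pi> (Suc k) + \<i> * of_real w * coeff \<pi> k"
  by (simp add: levin_poly_def coeff_pderiv algebra_simps)

lemma levin_poly_add:
  "levin_poly w \<alpha> (c + c') (\<pi> + \<pi>') = levin_poly w \<alpha> c \<pi> + levin_poly w \<alpha> c' \<pi>'"
  by (simp add: levin_poly_def pderiv_add smult_add_right algebra_simps)

lemma levin_poly_diff:
  "levin_poly w \<alpha> (c - c') (\<pi> - \<pi>') = levin_poly w \<alpha> c \<pi> - levin_poly w \<alpha> c' \<pi>'"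
  using levin_poly_add[of w \<alpha> "c - c'" c' "\<pi> - \<pi>'" \<pi>'] by simp

lemma levin_poly_inject:
  assumes "w \<noteq> 0" "levin_poly w \<alpha> c \<pi> = levin_poly w \<alpha> c' \<pi>'"
  shows "c = c' \<and> \<pi> = \<pi>'"
proof -
  have zero: "levin_poly w \<alpha> (c - c') (\<pi> - \<pi>') = 0"
    using assms(2) by (simp add: levin_poly_diff)
  have "\<pi> - \<pi>' = 0"
  proof (rule ccontr)
    let ?\<delta> = "\<pi> - \<pi>'"
    assume "?\<delta> \<noteq> 0"
    have "coeff (levin_poly w \<alpha> (c - c') ?\<delta>) (Suc (degree ?\<delta>)) = \<i> * of_real w * lead_coeff ?\<delta>"
      unfolding coeff_levin_poly_Suc coeff_eq_0[OF lessI] by simp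
    with zero \<open>?\<delta> \<noteq> 0\<close> assms(1) show False
      by (simp add: leading_coeff_0_iff del: coeff_diff)
  qed
  with zero assms(1) show ?thesis
    by (simp add: levin_poly_def)
qed

lemma degree_levin_poly:
  assumes "degree \<pi> < M"
  shows "degree (levin_poly w \<alpha> c \<pi>) \<le> M"
proof (rule degree_le, intro allI impI)
  fix i assume "M < i"
  then obtain k where "i = Suc k" "M \<le> k"
    by (cases i) auto
  with assms show "coeff (levin_poly w \<alpha> c \<pi>) i = 0"
    by (simp add: coeff_levin_poly_Suc coeff_eq_0)
qed

lemma levin_poly_surj:
  assumes "w \<noteq> 0" "degree \<rho> \<le> M"
  shows "\<exists>c \<pi>. degree \<pi> \<le> M - 1 \<and> levin_poly w \<alpha> c \<pi> = \<rho>"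
  using assms(2)
proof (induction M arbitrary: \<rho>)
  case 0
  then obtain r where "\<rho> = [:r:]"
    by (metis degree_0_id le_zero_eq)
  then have "levin_poly w \<alpha> (r / (\<i> * of_real w)) 0 = \<rho>"
    using assms(1) by (simp add: levin_poly_def)
  then show ?case
    by (intro exI[of _ "r / (\<i> * of_real w)"] exI[of _ 0]) simp
next
  case (Suc M)
  \<comment> \<open>The choice of \<open>b\<close> removes the coefficient of index \<open>M + 1\<close> from \<open>\<rho>\<close>.\<close>
  define b where "b = coeff \<rho> (Suc M) / (\<i> * of_real w)"
  have "degree (\<rho> - levin_poly w \<alpha> 0 (monom b M)) \<le> M"
  proof (rule degree_le, intro allI impI)
    fix i assume "M < i"
    then obtain k where k: "i = Suc k" "M \<le> k"
      by (cases i) auto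
    show "coeff (\<rho> - levin_poly w \<alpha> 0 (monom b M)) i = 0"
    proof (cases "k = M")
      case True
      then show ?thesis
        using assms(1) k by (simp add: coeff_levin_poly_Suc b_def)
    next
      case False
      then show ?thesis
        using k Suc.prems by (simp add: coeff_levin_poly_Suc coeff_eq_0)
    qed
  qed
  from Suc.IH[OF this] obtain c \<pi> where
    "degree \<pi> \<le> M - 1" "levin_poly w \<alpha> c \<pi> = \<rho> - levin_poly w \<alpha> 0 (monom b M)"
    by blast
  then have "degree (\<pi> + monom b M) \<le> M" "levin_poly w \<alpha> (c + 0) (\<pi> + monom b M) = \<rho>"
    by (auto simp: levin_poly_add[of w \<alpha> c 0 \<pi>, simplified]
        intro!: degree_add_le order.trans[OF degree_monom_le])
  then show ?case
    by (intro exI[of _ "c + 0"] exI[of _ "\<pi> + monom b M"]) simp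
qed

locale phase =
  fixes a :: real and g :: "real \<Rightarrow> real"
  assumes a_pos: "0 < a" and g_smooth: "smooth_on_Icc a g" and g_0: "g 0 = 0"
    and g'_pos: "\<And>t. t \<in> {0..a} \<Longrightarrow> 0 < deriv_on a g t"
begin

lemma g_has_deriv:
  "t \<in> {0..a} \<Longrightarrow> (g has_real_derivative deriv_on a g t) (at t within {0..a})"
  using smooth_has_deriv_on[OF g_smooth]
  by (simp add: has_real_derivative_iff_has_vector_derivative)

lemma g_continuous: "continuous_on {0..a} g"
  using g_has_deriv DERIV_continuous continuous_on_eq_continuous_within by blast

lemma g_less:
  assumes "0 \<le> s" "s < t" "t \<le> a"
  shows "g s < g t"
proof (rule DERIV_pos_imp_increasing_open[OF assms(2)])
  fix y assume "s < y" "y < t"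
  with assms have "y \<in> {0..a}" "0 < y" "y < a"
    by auto
  then show "\<exists>d. (g has_real_derivative d) (at y) \<and> 0 < d"
    using g_has_deriv[of y] g'_pos[of y] at_within_Icc_at[of 0 y a] by auto
next
  show "continuous_on {s..t} g"
    using assms by (intro continuous_on_subset[OF g_continuous]) auto
qed

lemma g_inj: "inj_on g {0..a}"
  by (rule linorder_inj_onI) (use g_less in \<open>auto simp: less_imp_neq\<close>)

abbreviation G :: "real \<Rightarrow> complex" where "G t \<equiv> of_real (g t)"

definition weighted_poly :: "complex poly \<Rightarrow> real \<Rightarrow> complex" where
  "weighted_poly \<pi> t = of_real (deriv_on a g t) * poly \<pi> (G t)"

lemma weighted_poly_lincomb:
  "weighted_poly (\<pi> + smult c \<rho>) = (\<lambda>t. weighted_poly \<pi> t + c * weighted_poly \<rho> t)"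
  by (auto simp: weighted_poly_def algebra_simps)

lemma cspan_Psi: "cspan (Psi a g) (M + 1) = {weighted_poly \<pi> |\<pi>. degree \<pi> \<le> M}"
  using cspan_powers[of "M + 1" "Psi a g" "\<lambda>t. of_real (deriv_on a g t)" G]
  by (simp add: Psi_def weighted_poly_def[abs_def] less_Suc_eq_le)

lemma cspan_Phi: "0 < M \<Longrightarrow> cspan (Phi g) M = {(\<lambda>t. poly \<pi> (G t)) |\<pi>. degree \<pi> < M}"
  using cspan_powers[of M "Phi g" "\<lambda>_. 1" G] by (simp add: Phi_def)

lemma deriv_G: "t \<in> {0..a} \<Longrightarrow> deriv_on a G t = of_real (deriv_on a g t)"
  by (intro deriv_on_eqI a_pos has_vector_derivative_of_real g_has_deriv)

lemma poly_G_has_deriv: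
  assumes "t \<in> {0..a}"
  shows "((\<lambda>t. poly \<pi> (G t)) has_vector_derivative
           of_real (deriv_on a g t) * poly (pderiv \<pi>) (G t)) (at t within {0..a})"
  using field_vector_diff_chain_within[OF has_vector_derivative_of_real[OF g_has_deriv[OF assms]]
      has_field_derivative_at_within[OF poly_DERIV]]
  by (simp add: comp_def)

lemma smooth_poly_G: "smooth_on_Icc a (\<lambda>t. poly \<pi> (G t))"
  by (induction \<pi>)
    (simp_all add: smooth_const smooth_add smooth_mult smooth_of_real a_pos g_smooth)

lemma smooth_weighted_poly: "smooth_on_Icc a (weighted_poly \<pi>)"
  unfolding weighted_poly_def[abs_def]
  by (intro smooth_mult smooth_of_real smooth_deriv_on smooth_poly_G g_smooth a_pos)

lemma levin_op_poly_G:
  assumes "t \<in> {0..a}"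
  shows "levin_op a w \<alpha> g c (\<lambda>t. poly \<pi> (G t)) t = weighted_poly (levin_poly w \<alpha> c \<pi>) t"
  unfolding levin_op_def deriv_on_eqI[OF a_pos assms poly_G_has_deriv[OF assms]]
  by (simp add: weighted_poly_def levin_poly_def algebra_simps)

lemma iterated_deriv_weighted_poly_root:
  assumes "t \<in> {0..a}" "\<pi> = [:- G t, 1:] ^ k * \<rho>"
  shows "j < k \<Longrightarrow> (deriv_on a ^^ j) (weighted_poly \<pi>) t = 0"
    and "(deriv_on a ^^ k) (weighted_poly \<pi>) t
           = fact k * of_real (deriv_on a g t) ^ k * weighted_poly \<rho> t"
proof -
  have *: "weighted_poly \<pi> = (\<lambda>s. (G s - G t) ^ k * weighted_poly \<rho> s)"
    using assms(2) by (auto simp: weighted_poly_def poly_power)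
  show "(deriv_on a ^^ j) (weighted_poly \<pi>) t = 0" if "j < k"
    unfolding *
    by (rule iterated_deriv_on_power_mult_less[OF a_pos smooth_of_real[OF a_pos g_smooth]
          smooth_weighted_poly assms(1) that])
  show "(deriv_on a ^^ k) (weighted_poly \<pi>) t
           = fact k * of_real (deriv_on a g t) ^ k * weighted_poly \<rho> t"
    unfolding *
    using iterated_deriv_on_power_mult_eq[OF a_pos smooth_of_real[OF a_pos g_smooth]
          smooth_weighted_poly assms(1)]
    by (simp add: deriv_G[OF assms(1)])
qed

end

section \<open>Hermite interpolation in powers of the phase\<close>

locale phase_nodes = phase a g for a g +
  fixes n :: nat and x :: "nat \<Rightarrow> real"
  assumes nodes: "\<And>l. l \<le> n \<Longrightarrow> x l \<in> {0..a}" and nodes_inj: "inj_on x {..n}"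
begin

lemma g_nodes_inj: "inj_on (\<lambda>l. G (x l)) {..n}"
proof (rule inj_onI)
  fix l l' assume "l \<in> {..n}" "l' \<in> {..n}" "G (x l) = G (x l')"
  then show "l = l'"
    using inj_onD[OF g_inj, of "x l" "x l'"] inj_onD[OF nodes_inj, of l l'] nodes[of l] nodes[of l']
    by simp
qed

text \<open>
  Newton's method, adding one condition at a time. To raise the multiplicity at the node \<open>x i\<close> by one,
  a multiple of \<open>\<omega> = \<Prod>\<^sub>l (X - g(x\<^sub>l))\<^bsup>m' l\<^esup>\<close> is added, where \<open>m'\<close> are the previous multiplicities.
  It respects all previous conditions, and its derivative of order \<open>m' i\<close> at \<open>x i\<close> is not \<open>0\<close>
  because \<open>g'\<close> has no zero and the \<open>g(x\<^sub>l)\<close> are distinct.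
\<close>

lemma hermite_exists:
  "\<exists>\<pi>. degree \<pi> \<le> (\<Sum>l\<le>n. m l) - 1 \<and> matches_at_nodes a n x m (weighted_poly \<pi>) v"
proof (induction "\<Sum>l\<le>n. m l" arbitrary: m)
  case 0
  then show ?case
    by (intro exI[of _ 0]) (simp add: matches_at_nodes_def)
next
  case (Suc N)
  then obtain i where i: "i \<le> n" "m i \<noteq> 0"
    by (metis atMost_iff nat.distinct(1) sum.neutral)
  define m' where "m' = m(i := m i - 1)"
  have "sum m {..n} = Suc (sum m' {..n})"
    using i by (simp add: m'_def sum.remove[of "{..n}" i])
  with Suc have N: "N = sum m' {..n}"
    by simp
  from Suc.hyps(1)[OF this] obtain \<pi> where
    \<pi>: "degree \<pi> \<le> N - 1" "matches_at_nodes a n x m' (weighted_poly \<pi>) v"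
    unfolding N by blast
  define \<omega> where "\<omega> = (\<Prod>l\<le>n. [:- G (x l), 1:] ^ m' l)"
  define \<omega>' where "\<omega>' l = (\<Prod>k\<in>{..n} - {l}. [:- G (x k), 1:] ^ m' k)" for l
  have factor: "\<omega> = [:- G (x l), 1:] ^ m' l * \<omega>' l" if "l \<le> n" for l
    using that by (simp add: \<omega>_def \<omega>'_def prod.remove[of "{..n}" l])
  have "degree \<omega> = N"
    unfolding \<omega>_def N by (subst degree_prod_eq_sum_degree) (auto simp: degree_linear_power)
  define D where "D = (deriv_on a ^^ m' i) (weighted_poly \<omega>) (x i)"
  have "poly (\<omega>' i) (G (x i)) \<noteq> 0"
    using i inj_onD[OF g_nodes_inj, of _ i] by (auto simp: \<omega>'_def poly_prod poly_power)
  then have "D \<noteq> 0"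
    unfolding D_def iterated_deriv_weighted_poly_root(2)[OF nodes[OF i(1)] factor[OF i(1)]]
    using g'_pos[OF nodes[OF i(1)]] by (simp add: weighted_poly_def)
  define c where "c = ((deriv_on a ^^ m' i) v (x i) - (deriv_on a ^^ m' i) (weighted_poly \<pi>) (x i)) / D"
  have "matches_at_nodes a n x m (weighted_poly (\<pi> + smult c \<omega>)) v"
    unfolding matches_at_nodes_def
  proof (intro allI impI)
    fix l j assume lj: "l \<le> n" "j < m l"
    have split: "(deriv_on a ^^ j) (weighted_poly (\<pi> + smult c \<omega>)) (x l)
        = (deriv_on a ^^ j) (weighted_poly \<pi>) (x l) + c * (deriv_on a ^^ j) (weighted_poly \<omega>) (x l)"
      unfolding weighted_poly_lincomb
      by (intro iterated_deriv_on_lincomb a_pos smooth_weighted_poly nodes lj)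
    show "(deriv_on a ^^ j) (weighted_poly (\<pi> + smult c \<omega>)) (x l) = (deriv_on a ^^ j) v (x l)"
    proof (cases "j < m' l")
      case True
      then show ?thesis
        unfolding split using \<pi>(2) lj iterated_deriv_weighted_poly_root(1)[OF nodes factor]
        by (simp add: matches_at_nodes_def)
    next
      case False
      with lj have "l = i" "j = m' i"
        by (auto simp: m'_def split: if_splits)
      with \<open>D \<noteq> 0\<close> show ?thesis
        unfolding split by (simp add: c_def D_def)
    qed
  qed
  moreover have "degree (\<pi> + smult c \<omega>) \<le> N"
    using \<pi>(1) \<open>degree \<omega> = N\<close> by (intro degree_add_le order.trans[OF degree_smult_le]) auto
  ultimately show ?case
    using Suc.hyps(2) by (metis diff_Suc_1)
qed

text \<open>
  The difference \<open>\<delta>\<close> of two interpolating polynomials vanishes at every \<open>g(x\<^sub>l)\<close> to order \<open>m l\<close>, hence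
  has more roots than its degree allows.
\<close>

lemma hermite_unique:
  assumes "degree \<pi> < (\<Sum>l\<le>n. m l)" "degree \<rho> < (\<Sum>l\<le>n. m l)"
    and "matches_at_nodes a n x m (weighted_poly \<pi>) v" "matches_at_nodes a n x m (weighted_poly \<rho>) v"
  shows "\<pi> = \<rho>"
proof (rule ccontr)
  define \<delta> where "\<delta> = \<pi> + smult (- 1) \<rho>"
  assume "\<pi> \<noteq> \<rho>"
  then have "\<delta> \<noteq> 0"
    by (simp add: \<delta>_def)
  have zero: "(deriv_on a ^^ j) (weighted_poly \<delta>) (x l) = 0" if "l \<le> n" "j < m l" for l j
    using assms(3,4) that unfolding \<delta>_def weighted_poly_lincomb
    by (subst iterated_deriv_on_lincomb[OF a_pos smooth_weighted_poly smooth_weighted_poly nodes])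
      (simp_all add: matches_at_nodes_def)
  have le: "m l \<le> order (G (x l)) \<delta>" if l: "l \<le> n" for l
  proof (rule ccontr)
    assume "\<not> m l \<le> order (G (x l)) \<delta>"
    then have less: "order (G (x l)) \<delta> < m l"
      by simp
    obtain \<tau> where \<tau>: "\<delta> = [:- G (x l), 1:] ^ order (G (x l)) \<delta> * \<tau>" "\<not> [:- G (x l), 1:] dvd \<tau>"
      using order_decomp[OF \<open>\<delta> \<noteq> 0\<close>] by blast
    from zero[OF l less] have "weighted_poly \<tau> (x l) = 0"
      unfolding iterated_deriv_weighted_poly_root(2)[OF nodes[OF l] \<tau>(1)]
      using g'_pos[OF nodes[OF l]] by simp
    with \<tau>(2) g'_pos[OF nodes[OF l]] show False
      by (simp add: weighted_poly_def poly_eq_0_iff_dvd)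
  qed
  let ?r = "\<lambda>l. G (x l)"
  have "(\<Sum>l\<le>n. m l) \<le> (\<Sum>l\<le>n. order (?r l) \<delta>)"
    by (rule sum_mono) (simp add: le)
  also have "\<dots> = (\<Sum>z\<in>?r ` {..n}. order z \<delta>)"
    by (simp add: sum.reindex[OF g_nodes_inj])
  also have "\<dots> = (\<Sum>z\<in>?r ` {..n} \<inter> {z. poly \<delta> z = 0}. order z \<delta>)"
    by (rule sum.mono_neutral_right) (auto simp: order_root)
  also have "\<dots> \<le> (\<Sum>z | poly \<delta> z = 0. order z \<delta>)"
    by (rule sum_mono2) (simp_all add: poly_roots_finite[OF \<open>\<delta> \<noteq> 0\<close>])
  also have "\<dots> \<le> degree \<delta>"
    by (rule sum_order_le_degree[OF \<open>\<delta> \<noteq> 0\<close>])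
  also have "\<dots> < (\<Sum>l\<le>n. m l)"
    unfolding \<delta>_def using assms(1,2) by (intro degree_add_less) auto
  finally show False
    by simp
qed

context
  fixes m :: "nat \<Rightarrow> nat" and M :: nat
  assumes M: "(\<Sum>l\<le>n. m l) = M + 1" and M_pos: "0 < M"
begin

lemma filon_interpolant_eq:
  assumes "degree \<pi> \<le> M" "matches_at_nodes a n x m (weighted_poly \<pi>) v"
  shows "filon_interpolant a g n x m M v = weighted_poly \<pi>"
  unfolding filon_interpolant_def cspan_Psi
proof (rule the_equality)
  show "weighted_poly \<pi> \<in> {weighted_poly \<pi> |\<pi>. degree \<pi> \<le> M} \<and>
      matches_at_nodes a n x m (weighted_poly \<pi>) v"
    using assms by blast
  show "P = weighted_poly \<pi>" if "P \<in> {weighted_poly \<pi> |\<pi>. degree \<pi> \<le> M} \<and>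
      matches_at_nodes a n x m P v" for P
    using that hermite_unique[of \<pi> m] assms M by (auto simp: less_Suc_eq_le)
qed

lemma levin_pair_eq:
  assumes "w \<noteq> 0" "degree \<pi> < M"
    and "matches_at_nodes a n x m (weighted_poly (levin_poly w \<alpha> c \<pi>)) v"
  shows "levin_pair a w \<alpha> g n x m M v = (c, \<lambda>t. poly \<pi> (G t))"
proof -
  have matches: "matches_at_nodes a n x m (levin_op a w \<alpha> g c (\<lambda>t. poly \<pi> (G t))) v
      \<longleftrightarrow> matches_at_nodes a n x m (weighted_poly (levin_poly w \<alpha> c \<pi>)) v" for c \<pi>
    by (rule matches_at_nodes_cong) (simp_all add: levin_op_poly_G nodes del: atLeastAtMost_iff)
  show ?thesis
    unfolding levin_pair_def cspan_Phi[OF M_pos]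
  proof (rule the_equality)
    show "case (c, \<lambda>t. poly \<pi> (G t)) of (c, q) \<Rightarrow>
        q \<in> {(\<lambda>t. poly \<pi> (G t)) |\<pi>. degree \<pi> < M} \<and>
        matches_at_nodes a n x m (levin_op a w \<alpha> g c q) v"
      using assms(2,3) by (auto simp: matches)
  next
    fix p assume "case p of (c, q) \<Rightarrow> q \<in> {(\<lambda>t. poly \<pi> (G t)) |\<pi>. degree \<pi> < M} \<and>
        matches_at_nodes a n x m (levin_op a w \<alpha> g c q) v"
    then obtain c' \<pi>' where p: "p = (c', \<lambda>t. poly \<pi>' (G t))" "degree \<pi>' < M"
      "matches_at_nodes a n x m (weighted_poly (levin_poly w \<alpha> c' \<pi>')) v"
      by (auto simp: matches)
    have "levin_poly w \<alpha> c' \<pi>' = levin_poly w \<alpha> c \<pi>"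
      by (rule hermite_unique[OF _ _ p(3) assms(3)])
        (use degree_levin_poly p(2) assms(2) M in \<open>simp_all add: less_Suc_eq_le\<close>)
    with levin_poly_inject[OF assms(1)] p(1) show "p = (c, \<lambda>t. poly \<pi> (G t))"
      by blast
  qed
qed

text \<open>
  Levin's collocation is Filon's interpolation in other coordinates. The pairs \<open>(c, q)\<close> correspond
  bijectively to the elements of the span of \<open>\<Psi>\<^bsub>M+1\<^esub>\<close> under \<open>levin_op\<close>, and among these only one
  matches given data; so the collocation solution is mapped to the Filon interpolant.
\<close>

lemma filon_levin_interpolants:
  assumes "w \<noteq> 0"
  obtains c \<pi> where
    "levin_pair a w \<alpha> g n x m M v = (c, \<lambda>t. poly \<pi> (G t))"
    "\<And>t. t \<in> {0..a} \<Longrightarrow>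
       filon_interpolant a g n x m M v t = levin_op a w \<alpha> g c (\<lambda>t. poly \<pi> (G t)) t"
    "degree \<pi> < M"
proof -
  obtain \<rho> where \<rho>: "degree \<rho> \<le> M" "matches_at_nodes a n x m (weighted_poly \<rho>) v"
    using hermite_exists[of m v] M by auto
  obtain c \<pi> where "degree \<pi> \<le> M - 1" and L: "levin_poly w \<alpha> c \<pi> = \<rho>"
    using levin_poly_surj[OF assms \<rho>(1)] by blast
  then have deg: "degree \<pi> < M"
    using M_pos by linarith
  show thesis
    using \<rho> levin_op_poly_G filon_interpolant_eq levin_pair_eq[OF assms deg]
    by (intro that[OF _ _ deg, of c]) (simp_all add: L del: atLeastAtMost_iff)
qed

text \<open>
  If the data already lie in the span, the interpolant reproduces them, and the collocation equation
  holds on all of \<open>[0, a]\<close> and not merely at the nodes.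
\<close>

lemma levin_pair_weighted_poly:
  assumes "w \<noteq> 0" "degree \<rho> \<le> M" "\<And>t. t \<in> {0..a} \<Longrightarrow> v t = weighted_poly \<rho> t"
  obtains d \<sigma> where "levin_pair a w \<alpha> g n x m M v = (d, \<lambda>t. poly \<sigma> (G t))"
    "\<And>t. t \<in> {0..a} \<Longrightarrow> levin_op a w \<alpha> g d (\<lambda>t. poly \<sigma> (G t)) t = v t"
proof -
  obtain d \<sigma> where d: "levin_pair a w \<alpha> g n x m M v = (d, \<lambda>t. poly \<sigma> (G t))"
    "\<And>t. t \<in> {0..a} \<Longrightarrow>
       filon_interpolant a g n x m M v t = levin_op a w \<alpha> g d (\<lambda>t. poly \<sigma> (G t)) t"
    using filon_levin_interpolants[OF assms(1)] by metis
  have "matches_at_nodes a n x m (weighted_poly \<rho>) v \<longleftrightarrow> matches_at_nodes a n x m v v"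
    by (rule matches_at_nodes_cong) (simp_all add: assms(3) nodes del: atLeastAtMost_iff)
  then have "filon_interpolant a g n x m M v = weighted_poly \<rho>"
    by (intro filon_interpolant_eq assms(2)) (simp add: matches_at_nodes_def)
  then show thesis
    using that d assms(3) by metis
qed

end

end

section \<open>An explicit antiderivative\<close>

text \<open>
  From \<open>ln y \<le> y\<close> for \<open>y = u\<^sup>\<epsilon>\<close> and \<open>y = u\<^sup>-\<^sup>\<epsilon>\<close>. The bound is uniform near \<open>0\<close> and
  controls every logarithm below at the price of an arbitrarily small power of \<open>u\<close>.
\<close>

lemma abs_ln_mult_powr_le:
  fixes u \<epsilon> :: real
  assumes "0 < u" "0 < \<epsilon>"
  shows "\<bar>ln u\<bar> * u powr \<epsilon> \<le> (u powr (2 * \<epsilon>) + 1) / \<epsilon>"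
proof -
  have "ln u * \<epsilon> \<le> u powr \<epsilon>" "- (ln u * \<epsilon>) \<le> u powr (- \<epsilon>)"
    using assms ln_bound[of "u powr \<epsilon>"] ln_bound[of "u powr (- \<epsilon>)"]
    by (simp_all add: ln_powr mult.commute)
  then have "\<bar>ln u\<bar> * \<epsilon> \<le> u powr \<epsilon> + u powr (- \<epsilon>)"
    by (cases "0 \<le> ln u") (smt (verit) powr_ge_zero minus_mult_left)+
  then have "\<bar>ln u\<bar> \<le> (u powr \<epsilon> + u powr (- \<epsilon>)) / \<epsilon>"
    using assms(2) by (simp add: pos_le_divide_eq)
  then have "\<bar>ln u\<bar> * u powr \<epsilon> \<le> (u powr \<epsilon> + u powr (- \<epsilon>)) / \<epsilon> * u powr \<epsilon>"
    by (rule mult_right_mono) simp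
  also have "\<dots> = (u powr (2 * \<epsilon>) + 1) / \<epsilon>"
    using assms by (simp add: field_simps flip: powr_add)
  finally show ?thesis .
qed

lemma norm_exp_i_minus_1_le: "norm (exp (\<i> * of_real s) - 1) \<le> \<bar>s\<bar>"
  using abs_sin_x_le_abs_x[of "s / 2"] by (simp add: dist_exp_i_1)

lemma norm_one_minus_osc_le: "norm (1 - osc w g t) \<le> \<bar>w\<bar> * \<bar>g t\<bar>"
  using norm_exp_i_minus_1_le[of "w * g t"]
  by (simp add: osc_def abs_mult norm_minus_commute mult.assoc)

lemma osc_uminus_mult: "osc (- w) g t * osc w g t = 1"
  by (simp add: osc_def flip: exp_add)

context phase
begin

lemma g_pos: "0 < t \<Longrightarrow> t \<le> a \<Longrightarrow> 0 < g t"
  using g_less[of 0 t] by (simp add: g_0)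

lemma g_le: "0 \<le> t \<Longrightarrow> t \<le> a \<Longrightarrow> g t \<le> g a"
  using g_less[of t a] by (cases "t = a") auto

lemma continuous_on_deriv_g: "continuous_on {0..a} (deriv_on a g)"
  unfolding continuous_on_eq_continuous_within
  using smooth_has_deriv_on[OF smooth_deriv_on[OF g_smooth]] has_vector_derivative_continuous
  by blast

lemma osc_has_deriv:
  assumes "t \<in> {0..a}"
  shows "(osc w g has_vector_derivative \<i> * of_real w * of_real (deriv_on a g t) * osc w g t)
           (at t within {0..a})"
proof -
  have "((\<lambda>z. exp (\<i> * of_real w * z)) has_field_derivative
      \<i> * of_real w * exp (\<i> * of_real w * G t)) (at (G t) within G ` {0..a})"
    by (auto intro!: derivative_eq_intros)
  from field_vector_diff_chain_within[OF has_vector_derivative_of_real[OF g_has_deriv[OF assms]] this]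
  show ?thesis
    by (simp add: comp_def osc_def[abs_def] mult_ac)
qed

lemma ln_g_has_deriv:
  assumes "t \<in> {0<..a}"
  shows "((\<lambda>t. ln (g t)) has_real_derivative deriv_on a g t / g t) (at t within {0..a})"
  using assms g_has_deriv[of t] g_pos[of t]
  by (auto intro!: derivative_eq_intros simp: field_simps)

lemma powr_g_has_deriv:
  assumes "t \<in> {0<..a}"
  shows "((\<lambda>t. g t powr \<beta>) has_real_derivative \<beta> * g t powr \<beta> / g t * deriv_on a g t)
           (at t within {0..a})"
  using assms g_has_deriv[of t] g_pos[of t]
  by (auto intro!: derivative_eq_intros simp: powr_diff field_simps)

lemma integrable_powr_g:
  assumes "- 1 < \<beta>"
  shows "(\<lambda>t. g t powr \<beta> * deriv_on a g t) integrable_on {0..a}"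
proof -
  have "((\<lambda>t. g t powr \<beta> * deriv_on a g t) has_integral
      g a powr (\<beta> + 1) / (\<beta> + 1) - g 0 powr (\<beta> + 1) / (\<beta> + 1)) {0..a}"
  proof (rule fundamental_theorem_of_calculus_interior)
    have "0 \<le> g t" if "t \<in> {0..a}" for t
      using that g_0 g_pos[of t] by (cases "t = 0") auto
    then have "continuous_on {0..a} (\<lambda>t. g t powr (\<beta> + 1))"
      using assms by (intro continuous_on_powr' g_continuous continuous_on_const) simp
    then show "continuous_on {0..a} (\<lambda>t. g t powr (\<beta> + 1) / (\<beta> + 1))"
      using assms by (intro continuous_on_divide continuous_on_const) auto
    fix t assume t: "t \<in> {0<..<a}"
    then have "0 < g t"
      using g_pos[of t] by auto
    then have "((\<lambda>t. g t powr (\<beta> + 1)) has_real_derivative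
        (\<beta> + 1) * (g t powr \<beta> * deriv_on a g t)) (at t)"
      using powr_g_has_deriv[of t "\<beta> + 1"] t at_within_Icc_at[of 0 t a] by (simp add: powr_add mult_ac)
    from DERIV_cdivide[OF this, of "\<beta> + 1"]
    have "((\<lambda>t. g t powr (\<beta> + 1) / (\<beta> + 1)) has_real_derivative
        g t powr \<beta> * deriv_on a g t) (at t)"
      using assms by simp
    then show "((\<lambda>t. g t powr (\<beta> + 1) / (\<beta> + 1)) has_vector_derivative
        g t powr \<beta> * deriv_on a g t) (at t)"
      by (simp add: has_real_derivative_iff_has_vector_derivative)
  qed (use a_pos in simp)
  then show ?thesis
    by blast
qed

text \<open>
  The common form of the integrands in the correction terms \<open>H\<close> and \<open>h\<close>.
\<close>

definition levin_kernel ::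
  "real \<Rightarrow> real \<Rightarrow> complex \<Rightarrow> complex \<Rightarrow> real \<Rightarrow> complex" where
  "levin_kernel w \<alpha> b e t = (b * of_real (ln (g t)) + e) * of_real (deriv_on a g t)
     * ((1 - osc w g t) / of_real (g t powr (1 - \<alpha>)))"

lemma continuous_on_levin_kernel: "continuous_on {0<..a} (levin_kernel w \<alpha> b e)"
proof -
  have g: "continuous_on {0<..a} g" and g': "continuous_on {0<..a} (deriv_on a g)"
    by (rule continuous_on_subset[OF g_continuous] continuous_on_subset[OF continuous_on_deriv_g];
        auto)+
  have "g t \<noteq> 0" if "t \<in> {0<..a}" for t
    using g_pos[of t] that by simp
  then show ?thesis
    unfolding levin_kernel_def[abs_def] osc_def
    by (intro continuous_intros g g') auto
qed

text \<open>
  Since \<open>\<bar>1 - e\<^bsup>iwg\<^esup>\<bar> \<le> \<bar>w\<bar> g\<close>, the kernel is of size \<open>(1 + \<bar>ln g\<bar>) g\<^sup>\<alpha> g'\<close>. Half of the distance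
  from \<open>\<alpha>\<close> to \<open>-1\<close> is spent on the logarithm, which leaves the integrable bound
  \<open>C g\<^bsup>\<epsilon>-1\<^esup> g'\<close> with \<open>\<epsilon> = (1 + \<alpha>) / 2 > 0\<close>.
\<close>

lemma integrable_levin_kernel:
  assumes "- 1 < \<alpha>"
  shows "levin_kernel w \<alpha> b e integrable_on {0..a}"
proof -
  define \<epsilon> where "\<epsilon> = (1 + \<alpha>) / 2"
  have \<epsilon>: "0 < \<epsilon>"
    using assms by (simp add: \<epsilon>_def)
  define C where "C = (norm b * ((g a powr (2 * \<epsilon>) + 1) / \<epsilon>) + norm e * g a powr \<epsilon>) * \<bar>w\<bar>"
  have bound: "norm (levin_kernel w \<alpha> b e t) \<le> C * (g t powr (\<epsilon> - 1) * deriv_on a g t)"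
    if t: "t \<in> {0<..<a}" for t
  proof -
    let ?u = "g t"
    have u: "0 < ?u" "?u \<le> g a" and g': "0 < deriv_on a g t"
      using t g_pos[of t] g_le[of t] g'_pos[of t] by auto
    have "\<bar>ln ?u\<bar> * ?u powr \<epsilon> \<le> (?u powr (2 * \<epsilon>) + 1) / \<epsilon>"
      by (rule abs_ln_mult_powr_le[OF u(1) \<epsilon>])
    also have "\<dots> \<le> (g a powr (2 * \<epsilon>) + 1) / \<epsilon>"
      using u \<epsilon> by (intro divide_right_mono add_right_mono powr_mono2) auto
    finally have ln: "\<bar>ln ?u\<bar> * ?u powr \<epsilon> \<le> (g a powr (2 * \<epsilon>) + 1) / \<epsilon>" .
    have pw: "?u powr \<epsilon> \<le> g a powr \<epsilon>"
      using u \<epsilon> by (intro powr_mono2) auto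
    have "norm (b * of_real (ln ?u) + e) * ?u powr \<epsilon> \<le> (norm b * \<bar>ln ?u\<bar> + norm e) * ?u powr \<epsilon>"
      using norm_triangle_ineq[of "b * of_real (ln ?u)" e]
      by (intro mult_right_mono) (simp_all add: norm_mult)
    also have "\<dots> = norm b * (\<bar>ln ?u\<bar> * ?u powr \<epsilon>) + norm e * ?u powr \<epsilon>"
      by (simp add: algebra_simps)
    also have "\<dots> \<le> norm b * ((g a powr (2 * \<epsilon>) + 1) / \<epsilon>) + norm e * g a powr \<epsilon>"
      by (intro add_mono mult_left_mono ln pw) auto
    finally have 1: "norm (b * of_real (ln ?u) + e) * ?u powr \<epsilon> * \<bar>w\<bar> \<le> C"
      unfolding C_def by (rule mult_right_mono) simp
    have "norm (levin_kernel w \<alpha> b e t) = norm (b * of_real (ln ?u) + e) * deriv_on a g t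
        * (norm (1 - osc w g t) / ?u powr (1 - \<alpha>))"
      using g' by (simp add: levin_kernel_def norm_mult norm_divide)
    also have "\<dots> \<le> norm (b * of_real (ln ?u) + e) * deriv_on a g t
        * ((\<bar>w\<bar> * ?u) / ?u powr (1 - \<alpha>))"
      using norm_one_minus_osc_le[of w g t] u g'
      by (intro mult_left_mono divide_right_mono) auto
    also have "?u / ?u powr (1 - \<alpha>) = ?u powr \<epsilon> * ?u powr (\<epsilon> - 1)"
    proof -
      have "?u / ?u powr (1 - \<alpha>) = ?u powr 1 / ?u powr (1 - \<alpha>)"
        using u by simp
      also have "\<dots> = ?u powr (1 - (1 - \<alpha>))"
        by (rule powr_diff[symmetric])
      also have "1 - (1 - \<alpha>) = \<epsilon> + (\<epsilon> - 1)"
        by (simp add: \<epsilon>_def field_simps)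
      also have "?u powr (\<epsilon> + (\<epsilon> - 1)) = ?u powr \<epsilon> * ?u powr (\<epsilon> - 1)"
        by (rule powr_add)
      finally show ?thesis .
    qed
    then have "norm (b * of_real (ln ?u) + e) * deriv_on a g t * ((\<bar>w\<bar> * ?u) / ?u powr (1 - \<alpha>))
        = (norm (b * of_real (ln ?u) + e) * ?u powr \<epsilon> * \<bar>w\<bar>) * (?u powr (\<epsilon> - 1) * deriv_on a g t)"
      unfolding times_divide_eq_right[symmetric] by (simp add: mult_ac)
    also have "\<dots> \<le> C * (?u powr (\<epsilon> - 1) * deriv_on a g t)"
      using g' by (intro mult_right_mono 1) simp
    finally show ?thesis .
  qed
  have "levin_kernel w \<alpha> b e integrable_on {0<..<a}"
  proof (rule measurable_bounded_by_integrable_imp_integrable)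
    show "levin_kernel w \<alpha> b e \<in> borel_measurable (lebesgue_on {0<..<a})"
      by (intro continuous_imp_measurable_on_sets_lebesgue
          continuous_on_subset[OF continuous_on_levin_kernel]) auto
    show "(\<lambda>t. C * (g t powr (\<epsilon> - 1) * deriv_on a g t)) integrable_on {0<..<a}"
      unfolding integrable_on_Icc_iff_Ioo[symmetric]
      by (rule integrable_on_mult_right, rule integrable_powr_g) (use \<epsilon> in simp)
  qed (use bound in auto)
  then show ?thesis
    by (simp add: integrable_on_Icc_iff_Ioo)
qed

text \<open>
  The function between the brackets of the Levin method, multiplied out so that no \<open>e\<^bsup>-iwg\<^esup>\<close> remains.
  With \<open>c = 0\<close> and \<open>q = 0\<close> it is the one for the purely algebraic singularity, so both methods are
  covered by a single computation.
\<close>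

definition levin_primitive ::
  "real \<Rightarrow> real \<Rightarrow> complex \<Rightarrow> (real \<Rightarrow> complex) \<Rightarrow> complex \<Rightarrow> (real \<Rightarrow> complex) \<Rightarrow> real \<Rightarrow> complex" where
  "levin_primitive w \<alpha> c q d l t =
     (q t * of_real (ln (g t)) + l t) * of_real (g t powr (1 + \<alpha>)) * osc w g t
     + (c * of_real (ln (g t)) + d) * (osc w g t - 1) * of_real (g t powr \<alpha>)
     + integral {0..t} (levin_kernel w \<alpha> (of_real \<alpha> * c) (of_real \<alpha> * d + c))"

text \<open>
  The terms \<open>q ln g + l\<close> produce the right-hand side except for the parts of \<open>levin_op\<close> that involve
  \<open>c\<close> and \<open>d\<close>, and the extra \<open>q g'\<close> comes from differentiating the logarithm. The constants are
  supplied by \<open>(c ln g + d) e\<^bsup>iwg\<^esup> g\<^sup>\<alpha>\<close>. For negative \<open>\<alpha>\<close> that expression would be unbounded at \<open>0\<close>,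
  which is why \<open>e\<^bsup>iwg\<^esup>\<close> is replaced there by \<open>e\<^bsup>iwg\<^esup> - 1\<close>. The derivatives of \<open>g\<^sup>\<alpha>\<close> and \<open>ln g\<close>
  in that term are unwanted, and the integral of the kernel is chosen to cancel exactly these.
\<close>

lemma levin_primitive_has_deriv:
  assumes "- 1 < \<alpha>" and t: "t \<in> {0<..a}"
    and q: "\<And>t. t \<in> {0..a} \<Longrightarrow> (q has_vector_derivative deriv_on a q t) (at t within {0..a})"
    and l: "\<And>t. t \<in> {0..a} \<Longrightarrow> (l has_vector_derivative deriv_on a l t) (at t within {0..a})"
  shows "(levin_primitive w \<alpha> c q d l has_vector_derivative
           (levin_op a w \<alpha> g c q t * of_real (ln (g t)) + q t * of_real (deriv_on a g t)
             + levin_op a w \<alpha> g d l t) * of_real (g t powr \<alpha>) * osc w g t) (at t within {0..a})"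
proof -
  let ?K = "levin_kernel w \<alpha> (of_real \<alpha> * c) (of_real \<alpha> * d + c)"
  have t': "t \<in> {0..a}" and g: "0 < g t"
    using t g_pos by auto
  have ln: "((\<lambda>t. of_real (ln (g t)) :: complex) has_vector_derivative
      of_real (deriv_on a g t / g t)) (at t within {0..a})"
    by (rule has_vector_derivative_of_real[OF ln_g_has_deriv[OF t]])
  have pw: "((\<lambda>t. of_real (g t powr \<beta>) :: complex) has_vector_derivative
      of_real (\<beta> * g t powr \<beta> / g t * deriv_on a g t)) (at t within {0..a})" for \<beta>
    by (rule has_vector_derivative_of_real[OF powr_g_has_deriv[OF t]])
  \<comment> \<open>The kernel need not be continuous at \<open>0\<close>, so that point is left out of the domain for a moment.\<close>
  have "continuous (at t within {0<..a}) ?K"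
    using continuous_on_levin_kernel t by (auto simp: continuous_on_eq_continuous_within)
  then have "continuous (at t within {0..a} - {0}) ?K"
    by (rule continuous_within_subset) auto
  from integral_has_vector_derivative_continuous_at[OF
      integrable_levin_kernel[OF assms(1)] _ _ this]
  have "((\<lambda>t. integral {0..t} ?K) has_vector_derivative ?K t) (at t within {0..a} - {0})"
    using t by auto
  moreover have "at t within {0..a} - {0} = at t within {0..a}"
    by (rule at_within_nhd[of _ "{0<..}"]) (use t in auto)
  ultimately have int: "((\<lambda>t. integral {0..t} ?K) has_vector_derivative ?K t) (at t within {0..a})"
    by simp
  have gne: "G t \<noteq> 0" "(of_real (g t powr \<alpha>) :: complex) \<noteq> 0"
    using g by auto
  have pw1: "(of_real (g t powr (1 + \<alpha>)) :: complex) = G t * of_real (g t powr \<alpha>)"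
    and pw2: "(of_real (g t powr (1 - \<alpha>)) :: complex) = G t / of_real (g t powr \<alpha>)"
    using g by (simp_all add: powr_add powr_diff)
  note derivs = has_vector_derivative_add has_vector_derivative_mult has_vector_derivative_diff
    has_vector_derivative_const ln pw int osc_has_deriv[OF t'] q[OF t'] l[OF t']
  show ?thesis
    unfolding levin_primitive_def[abs_def]
  proof (rule has_vector_derivative_eq_rhs, (rule derivs)+, goal_cases)
    case 1
    show ?case
      unfolding levin_kernel_def levin_op_def of_real_mult of_real_divide of_real_add of_real_1 pw1 pw2
      using gne by (simp add: divide_simps) (simp add: algebra_simps)
  qed
qed

lemma eventually_g_pos: "\<forall>\<^sub>F t in at_right 0. 0 < g t"
  using eventually_at_right_real[OF a_pos] by eventually_elim (simp add: g_pos)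

lemma tendsto_at_right_0:
  fixes u :: "real \<Rightarrow> 'a::topological_space"
  shows "continuous_on {0..a} u \<Longrightarrow> (u \<longlongrightarrow> u 0) (at_right 0)"
  using continuous_on_Icc_at_rightD a_pos by blast

lemma tendsto_powr_g:
  assumes "0 < \<beta>"
  shows "((\<lambda>t. g t powr \<beta>) \<longlongrightarrow> 0) (at_right 0)"
proof -
  have "((\<lambda>t. g t powr \<beta>) \<longlongrightarrow> 0 powr \<beta>) (at_right 0)"
    using assms tendsto_at_right_0[OF g_continuous] eventually_g_pos
    by (intro tendsto_powr2 tendsto_const) (auto simp: g_0 elim: eventually_mono)
  then show ?thesis
    by simp
qed

lemma tendsto_ln_g_powr_g:
  assumes "0 < \<beta>"
  shows "((\<lambda>t. \<bar>ln (g t)\<bar> * g t powr \<beta>) \<longlongrightarrow> 0) (at_right 0)"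
proof (rule Lim_null_comparison)
  show "\<forall>\<^sub>F t in at_right 0. norm (\<bar>ln (g t)\<bar> * g t powr \<beta>)
      \<le> (g t powr \<beta> + 1) / (\<beta> / 2) * g t powr (\<beta> / 2)"
    using eventually_g_pos
  proof eventually_elim
    case (elim t)
    have "\<bar>ln (g t)\<bar> * g t powr (\<beta> / 2) \<le> (g t powr \<beta> + 1) / (\<beta> / 2)"
      using abs_ln_mult_powr_le[OF elim, of "\<beta> / 2"] assms by simp
    from mult_right_mono[OF this, of "g t powr (\<beta> / 2)"] show ?case
      by (simp add: abs_mult mult.assoc flip: powr_add)
  qed
  have "((\<lambda>t. (g t powr \<beta> + 1) / (\<beta> / 2) * g t powr (\<beta> / 2)) \<longlongrightarrow> (0 + 1) / (\<beta> / 2) * 0) (at_right 0)"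
    using assms by (intro tendsto_intros tendsto_powr_g) auto
  then show "((\<lambda>t. (g t powr \<beta> + 1) / (\<beta> / 2) * g t powr (\<beta> / 2)) \<longlongrightarrow> 0) (at_right 0)"
    by simp
qed

lemma levin_primitive_tendsto:
  assumes \<alpha>: "- 1 < \<alpha>" and q: "continuous_on {0..a} q" and l: "continuous_on {0..a} l"
  shows "(levin_primitive w \<alpha> c q d l \<longlongrightarrow> 0) (at_right 0)"
proof -
  let ?K = "levin_kernel w \<alpha> (of_real \<alpha> * c) (of_real \<alpha> * d + c)"
  have pow: "((\<lambda>t. g t powr (1 + \<alpha>)) \<longlongrightarrow> 0) (at_right 0)"
    and log: "((\<lambda>t. \<bar>ln (g t)\<bar> * g t powr (1 + \<alpha>)) \<longlongrightarrow> 0) (at_right 0)"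
    using tendsto_powr_g tendsto_ln_g_powr_g \<alpha> by simp_all
  have logc: "((\<lambda>t. of_real (ln (g t) * g t powr (1 + \<alpha>)) :: complex) \<longlongrightarrow> 0) (at_right 0)"
    by (rule tendsto_norm_zero_cancel) (use log in \<open>simp add: abs_mult norm_mult\<close>)
  have powc: "((\<lambda>t. of_real (g t powr (1 + \<alpha>)) :: complex) \<longlongrightarrow> 0) (at_right 0)"
    using tendsto_of_real[OF pow] by simp
  have osc: "continuous_on {0..a} (osc w g)"
    unfolding osc_def by (intro continuous_intros g_continuous)
  have "((\<lambda>t. (q t * of_real (ln (g t) * g t powr (1 + \<alpha>)) + l t * of_real (g t powr (1 + \<alpha>))) * osc w g t)
      \<longlongrightarrow> (q 0 * 0 + l 0 * 0) * osc w g 0) (at_right 0)"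
    by (intro tendsto_intros logc powc tendsto_at_right_0 q l osc)
  then have 1: "((\<lambda>t. (q t * of_real (ln (g t)) + l t) * of_real (g t powr (1 + \<alpha>)) * osc w g t)
      \<longlongrightarrow> 0) (at_right 0)"
    by (simp add: algebra_simps)
  have 2: "((\<lambda>t. (c * of_real (ln (g t)) + d) * (osc w g t - 1) * of_real (g t powr \<alpha>))
      \<longlongrightarrow> 0) (at_right 0)"
  proof (rule Lim_null_comparison)
    show "\<forall>\<^sub>F t in at_right 0. norm ((c * of_real (ln (g t)) + d) * (osc w g t - 1) * of_real (g t powr \<alpha>))
        \<le> \<bar>w\<bar> * (norm c * (\<bar>ln (g t)\<bar> * g t powr (1 + \<alpha>)) + norm d * g t powr (1 + \<alpha>))"
      using eventually_g_pos
    proof eventually_elim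
      case (elim t)
      have "norm (c * of_real (ln (g t)) + d) \<le> norm c * \<bar>ln (g t)\<bar> + norm d"
        using norm_triangle_ineq[of "c * of_real (ln (g t))" d] by (simp add: norm_mult)
      then have "norm (c * of_real (ln (g t)) + d) * norm (osc w g t - 1) * g t powr \<alpha>
          \<le> (norm c * \<bar>ln (g t)\<bar> + norm d) * (\<bar>w\<bar> * \<bar>g t\<bar>) * g t powr \<alpha>"
        using norm_one_minus_osc_le[of w g t]
        by (intro mult_mono mult_right_mono) (simp_all add: norm_minus_commute)
      also have "\<dots> = \<bar>w\<bar> * (norm c * (\<bar>ln (g t)\<bar> * g t powr (1 + \<alpha>)) + norm d * g t powr (1 + \<alpha>))"
        using elim by (simp add: powr_add algebra_simps)
      finally show ?case
        by (simp add: norm_mult)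
    qed
    have "((\<lambda>t. \<bar>w\<bar> * (norm c * (\<bar>ln (g t)\<bar> * g t powr (1 + \<alpha>)) + norm d * g t powr (1 + \<alpha>)))
        \<longlongrightarrow> \<bar>w\<bar> * (norm c * 0 + norm d * 0)) (at_right 0)"
      by (intro tendsto_intros log pow)
    then show "((\<lambda>t. \<bar>w\<bar> * (norm c * (\<bar>ln (g t)\<bar> * g t powr (1 + \<alpha>)) + norm d * g t powr (1 + \<alpha>)))
        \<longlongrightarrow> 0) (at_right 0)"
      by simp
  qed
  have "((\<lambda>t. integral {0..t} ?K) \<longlongrightarrow> integral {0..0} ?K) (at_right 0)"
    by (intro tendsto_at_right_0 indefinite_integral_continuous_1 integrable_levin_kernel \<alpha>)
  with tendsto_add[OF tendsto_add[OF 1 2]] show ?thesis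
    unfolding levin_primitive_def[abs_def] by fastforce
qed

text \<open>
  The antiderivative tends to \<open>0\<close> at the singular end point, and its value there is also \<open>0\<close>, because
  \<open>0 powr \<beta> = 0\<close> for every \<open>\<beta>\<close>. So it is continuous on \<open>[0, a]\<close>, and the fundamental theorem applies
  even though the integrand may be unbounded near \<open>0\<close>.
\<close>

lemma levin_integral:
  assumes \<alpha>: "- 1 < \<alpha>"
    and q: "\<And>t. t \<in> {0..a} \<Longrightarrow> (q has_vector_derivative deriv_on a q t) (at t within {0..a})"
    and l: "\<And>t. t \<in> {0..a} \<Longrightarrow> (l has_vector_derivative deriv_on a l t) (at t within {0..a})"
  shows "((\<lambda>t. (levin_op a w \<alpha> g c q t * of_real (ln (g t)) + q t * of_real (deriv_on a g t)
             + levin_op a w \<alpha> g d l t) * of_real (g t powr \<alpha>) * osc w g t)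
           has_integral bracket a (levin_primitive w \<alpha> c q d l)) {0..a}"
proof -
  let ?B = "levin_primitive w \<alpha> c q d l"
  have "continuous_on {0..a} q" "continuous_on {0..a} l"
    unfolding continuous_on_eq_continuous_within
    using q l has_vector_derivative_continuous by blast+
  then have lim: "(?B \<longlongrightarrow> 0) (at_right 0)"
    by (rule levin_primitive_tendsto[OF \<alpha>])
  have B0: "?B 0 = 0"
    by (simp add: levin_primitive_def g_0)
  note deriv = levin_primitive_has_deriv[OF \<alpha> _ q l]
  have "continuous_on {0..a} ?B"
    unfolding continuous_on_eq_continuous_within
  proof
    fix t assume t: "t \<in> {0..a}"
    show "continuous (at t within {0..a}) ?B"
    proof (cases "t = 0")
      case True
      then show ?thesis
        using lim by (simp add: continuous_within B0 at_within_Icc_at_right[OF a_pos])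
    next
      case False
      with t show ?thesis
        using deriv[of t] has_vector_derivative_continuous by fastforce
    qed
  qed
  moreover have "(?B has_vector_derivative
      (levin_op a w \<alpha> g c q t * of_real (ln (g t)) + q t * of_real (deriv_on a g t)
        + levin_op a w \<alpha> g d l t) * of_real (g t powr \<alpha>) * osc w g t) (at t)"
    if "t \<in> {0<..<a}" for t
    using deriv[of t w c d] that by (simp add: at_within_Icc_at)
  ultimately have "((\<lambda>t. (levin_op a w \<alpha> g c q t * of_real (ln (g t)) + q t * of_real (deriv_on a g t)
             + levin_op a w \<alpha> g d l t) * of_real (g t powr \<alpha>) * osc w g t)
           has_integral ?B a - ?B 0) {0..a}"
    using a_pos by (intro fundamental_theorem_of_calculus_interior) auto
  moreover have "Lim (at_right 0) ?B = 0"
    by (rule tendsto_Lim[OF _ lim]) simp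
  ultimately show ?thesis
    by (simp add: bracket_def B0)
qed

text \<open>
  The two bracket functions in the form in which the methods state them; the factors
  \<open>e\<^bsup>iwg\<^esup>\<close> and \<open>e\<^bsup>-iwg\<^esup>\<close> cancel.
\<close>

lemma levin_primitive_log:
  "levin_primitive w \<alpha> c q d l = (\<lambda>t. ((q t * of_real (ln (g t)) + l t) * of_real (g t powr (1 + \<alpha>))
     + (c * of_real (ln (g t)) + d) * (1 - osc (- w) g t) * of_real (g t powr \<alpha>)
     + osc (- w) g t *
         integral {0..t} (\<lambda>\<tau>. (of_real \<alpha> * c * of_real (ln (g \<tau>)) + of_real \<alpha> * d + c)
            * of_real (deriv_on a g \<tau>) * ((1 - osc w g \<tau>) / of_real (g \<tau> powr (1 - \<alpha>))))) * osc w g t)"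
proof
  fix t
  have *: "(A * P + B * (1 - E') * R + E' * I) * E = A * P * E + B * (E - 1) * R + I"
    if "E' * E = 1" for A B P R E E' I :: complex
    using that by algebra
  show "levin_primitive w \<alpha> c q d l t = ((q t * of_real (ln (g t)) + l t) * of_real (g t powr (1 + \<alpha>))
     + (c * of_real (ln (g t)) + d) * (1 - osc (- w) g t) * of_real (g t powr \<alpha>)
     + osc (- w) g t *
         integral {0..t} (\<lambda>\<tau>. (of_real \<alpha> * c * of_real (ln (g \<tau>)) + of_real \<alpha> * d + c)
            * of_real (deriv_on a g \<tau>) * ((1 - osc w g \<tau>) / of_real (g \<tau> powr (1 - \<alpha>))))) * osc w g t"
    unfolding *[OF osc_uminus_mult] levin_primitive_def levin_kernel_def[abs_def] add.assoc[of "_ * of_real (ln _)"] ..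
qed

lemma levin_primitive_alg:
  "levin_primitive w \<alpha> 0 (\<lambda>_. 0) \<gamma> r = (\<lambda>t. (of_real (g t powr (\<alpha> + 1)) * r t
     + \<gamma> * (1 - osc (- w) g t) * of_real (g t powr \<alpha>)
     + of_real \<alpha> * \<gamma> * osc (- w) g t *
         integral {0..t} (\<lambda>\<tau>. of_real (deriv_on a g \<tau>) * (1 - osc w g \<tau>)
            / of_real (g \<tau> powr (1 - \<alpha>)))) * osc w g t)"
proof
  fix t
  have "integral {0..t} (\<lambda>\<tau>. of_real \<alpha> * \<gamma> * of_real (deriv_on a g \<tau>)
            * ((1 - osc w g \<tau>) / of_real (g \<tau> powr (1 - \<alpha>))))
      = of_real \<alpha> * \<gamma> * integral {0..t} (\<lambda>\<tau>. of_real (deriv_on a g \<tau>) * (1 - osc w g \<tau>)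
            / of_real (g \<tau> powr (1 - \<alpha>)))"
    by (subst integral_mult_right[symmetric]) (simp add: mult.assoc)
  then show "levin_primitive w \<alpha> 0 (\<lambda>_. 0) \<gamma> r t = (of_real (g t powr (\<alpha> + 1)) * r t
     + \<gamma> * (1 - osc (- w) g t) * of_real (g t powr \<alpha>)
     + of_real \<alpha> * \<gamma> * osc (- w) g t *
         integral {0..t} (\<lambda>\<tau>. of_real (deriv_on a g \<tau>) * (1 - osc w g \<tau>)
            / of_real (g \<tau> powr (1 - \<alpha>)))) * osc w g t"
    by (simp add: levin_primitive_log add.commute[of 1 \<alpha>] mult_ac)
qed

end

section \<open>The two methods agree\<close>

context phase_nodes
begin

lemma poly_G_has_deriv_on:
  "t \<in> {0..a} \<Longrightarrow> ((\<lambda>t. poly \<pi> (G t)) has_vector_derivative deriv_on a (\<lambda>t. poly \<pi> (G t)) t)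
     (at t within {0..a})"
  by (rule smooth_has_deriv_on[OF smooth_poly_G])

context
  fixes m :: "nat \<Rightarrow> nat" and M :: nat and w \<alpha> :: real
  assumes M: "(\<Sum>l\<le>n. m l) = M + 1" and M_pos: "0 < M" and w: "w \<noteq> 0" and \<alpha>: "- 1 < \<alpha>"
begin

lemma filon_alg_eq_levin_alg: "filon_alg a w \<alpha> g n x m M F = levin_alg a w \<alpha> g n x m M F"
proof -
  let ?v = "reg_alg a \<alpha> g F"
  obtain \<gamma> \<pi> where
    L: "levin_pair a w \<alpha> g n x m M ?v = (\<gamma>, \<lambda>t. poly \<pi> (G t))" and
    P: "\<And>t. t \<in> {0..a} \<Longrightarrow>
      filon_interpolant a g n x m M ?v t = levin_op a w \<alpha> g \<gamma> (\<lambda>t. poly \<pi> (G t)) t"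
    and "degree \<pi> < M"
    using filon_levin_interpolants[OF M M_pos w, where v = ?v and \<alpha> = \<alpha>] by blast
  have zero: "((\<lambda>_. 0 :: complex) has_vector_derivative deriv_on a (\<lambda>_. 0) t) (at t within {0..a})"
    if "t \<in> {0..a}" for t
    by (rule smooth_has_deriv_on[OF smooth_const[OF a_pos] that])
  have op0: "levin_op a w \<alpha> g 0 (\<lambda>_. 0) t = 0" if "t \<in> {0..a}" for t
    using deriv_on_eqI[OF a_pos that has_vector_derivative_const, of "0 :: complex"]
    by (simp add: levin_op_def)
  have "filon_alg a w \<alpha> g n x m M F = integral {0..a} (\<lambda>t.
      (levin_op a w \<alpha> g 0 (\<lambda>_. 0) t * of_real (ln (g t)) + 0 * of_real (deriv_on a g t)
        + levin_op a w \<alpha> g \<gamma> (\<lambda>t. poly \<pi> (G t)) t) * of_real (g t powr \<alpha>) * osc w g t)"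
    unfolding filon_alg_def Let_def by (rule integral_cong) (simp add: P op0 del: atLeastAtMost_iff)
  also have "\<dots> = bracket a (levin_primitive w \<alpha> 0 (\<lambda>_. 0) \<gamma> (\<lambda>t. poly \<pi> (G t)))"
    by (rule integral_unique[OF levin_integral[OF \<alpha> zero poly_G_has_deriv_on]])
  also have "\<dots> = levin_alg a w \<alpha> g n x m M F"
    unfolding levin_alg_def L levin_primitive_alg by simp
  finally show ?thesis .
qed

text \<open>
  The second collocation problem has the right-hand side \<open>- q g'\<close>, which lies in the span of
  \<open>\<Psi>\<^bsub>M+1\<^esub>\<close> because \<open>q\<close> is a polynomial of degree below \<open>M\<close> in \<open>g\<close>. Its solution is therefore exact on
  \<open>[0, a]\<close>, and \<open>levin_op\<close> of \<open>(d, l)\<close> cancels the term \<open>q g'\<close> left over from the logarithm.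
\<close>

lemma filon_log_eq_levin_log: "filon_log a w \<alpha> g n x m M f = levin_log a w \<alpha> g n x m M f"
proof -
  let ?v = "reg_alg a \<alpha> g f"
  obtain c \<pi> where
    c: "levin_pair a w \<alpha> g n x m M ?v = (c, \<lambda>t. poly \<pi> (G t))" and
    P: "\<And>t. t \<in> {0..a} \<Longrightarrow>
      filon_interpolant a g n x m M ?v t = levin_op a w \<alpha> g c (\<lambda>t. poly \<pi> (G t)) t"
    and deg: "degree \<pi> < M"
    using filon_levin_interpolants[OF M M_pos w, where v = ?v and \<alpha> = \<alpha>] by blast
  let ?q = "\<lambda>t. poly \<pi> (G t)"
  let ?v' = "\<lambda>t. - ?q t * of_real (deriv_on a g t)"
  obtain d \<sigma> where
    d: "levin_pair a w \<alpha> g n x m M ?v' = (d, \<lambda>t. poly \<sigma> (G t))" and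
    op: "\<And>t. t \<in> {0..a} \<Longrightarrow> levin_op a w \<alpha> g d (\<lambda>t. poly \<sigma> (G t)) t = ?v' t"
    by (rule levin_pair_weighted_poly[OF M M_pos w, where \<rho> = "- \<pi>" and v = ?v' and \<alpha> = \<alpha>])
      (use deg in \<open>simp_all add: weighted_poly_def mult.commute\<close>)
  let ?l = "\<lambda>t. poly \<sigma> (G t)"
  have "integral {0..a} (\<lambda>t. filon_interpolant a g n x m M ?v t * of_real (g t powr \<alpha>)
      * of_real (ln (g t)) * osc w g t) = integral {0..a} (\<lambda>t.
      (levin_op a w \<alpha> g c ?q t * of_real (ln (g t)) + ?q t * of_real (deriv_on a g t)
        + levin_op a w \<alpha> g d ?l t) * of_real (g t powr \<alpha>) * osc w g t)"
    by (rule integral_cong) (simp add: P op mult_ac del: atLeastAtMost_iff)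
  also have "\<dots> = bracket a (levin_primitive w \<alpha> c ?q d ?l)"
    by (rule integral_unique[OF levin_integral[OF \<alpha> poly_G_has_deriv_on poly_G_has_deriv_on]])
  finally show ?thesis
    unfolding filon_log_def levin_log_def filon_alg_eq_levin_alg Let_def c d prod.case
      levin_primitive_log by (simp only:)
qed

end

end

theorem theorem3p3:
  fixes a w \<alpha> :: real
    and f :: "real \<Rightarrow> complex" and g :: "real \<Rightarrow> real"
    and n M :: nat and x :: "nat \<Rightarrow> real" and m :: "nat \<Rightarrow> nat"
  assumes "a > 0" and "w \<noteq> 0" and "0 < \<bar>\<alpha>\<bar>" and "\<bar>\<alpha>\<bar> < 1"
    and "smooth_on_Icc a f" and "smooth_on_Icc a g"
    and "g 0 = 0" and "\<forall>t\<in>{0..a}. deriv_on a g t > 0"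
    and "x 0 = 0" and "\<forall>l<n. x l < x (Suc l)" and "x n = a"
    and "\<forall>l\<le>n. m l \<ge> 1"
    and "M = (\<Sum>j\<le>n. m j) - 1"
  shows "filon_log a w \<alpha> g n x m M f = levin_log a w \<alpha> g n x m M f"
proof -
  have less: "x k < x l" if "k < l" "l \<le> n" for k l
    using that
  proof (induction l)
    case (Suc l)
    then have "x l < x (Suc l)" "k < l \<or> k = l"
      using assms(10) by auto
    with Suc show ?case by auto
  qed simp
  have "x l \<in> {0..a}" if "l \<le> n" for l
    using that assms(9,11) less[of 0 l] less[of l n] by (cases "l = 0"; cases "l = n") auto
  moreover have "inj_on x {..n}"
    by (rule linorder_inj_onI) (auto dest: less)
  ultimately interpret phase_nodes a g n x
    using assms by unfold_locales auto
  have "0 < n"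
    using assms(1,9,11) by (cases n) auto
  \<comment> \<open>The end points are two different nodes, so there are at least two conditions and \<open>M > 0\<close>.\<close>
  have "(\<Sum>l\<in>{0, n}. m l) \<le> (\<Sum>l\<le>n. m l)"
    by (rule sum_mono2) auto
  moreover have "1 \<le> m 0" "1 \<le> m n"
    using assms(12) by auto
  ultimately have "2 \<le> (\<Sum>l\<le>n. m l)"
    using \<open>0 < n\<close> by simp
  with assms show ?thesis
    by (intro filon_log_eq_levin_log) auto
qed

end
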